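(* Let $n=r_0>r_1>\dots>r_\rho>0=:r_{\rho+1}$ be integers and let $\mathrm{Fl}(n;r_1,\dots,r_\rho)$ be the flag variety of successive quotients $\mathbb{C}^n\to V_1\to\cdots\to V_\rho\to 0$, $\dim V_i=r_i$. Let $W_P$ be its Plücker coordinate superpotential, let $W_R$ be the pullback of $W_P$ along the rectangles cluster chart of $Y=\prod_{i=1}^{\rho}\mathrm{Gr}(r_{i-1},r_{i-1}-r_i)$ (so $W_R$ is a Laurent polynomial in the rectangular Plücker coordinates $p^i_{a\times b}$, $1\le i\le\rho$, $1\le a\le r_i$, $1\le b\le r_{i-1}-r_i$, with coefficients in $\mathbb{Z}[q_1,\dots,q_\rho]$, normalized by $p^i_\emptyset=1$), and let $W_T$ be the Batyrev--Ciocan-Fontanine--Kim--van Straten mirror of $\mathrm{Fl}(n;r_1,\dots,r_\rho)$, a Laurent polynomial in variables $z^i_{a,b}$ with the same index set, depending on parameters $\tilde q_1,\dots,\tilde q_\rho$ (all defined in the context). Then $W_R$ and $W_T$ are isomorphic. Precisely, the monomial change of variables $\phi$ given by $$z^i_{a,b}\longmapsto q_1\cdots q_{i-1}\,\frac{p^i_{a\times b}}{p^i_{(a-1)\times(b-1)}},\qquad \tilde q_i\longmapsto q_1q_2\cdots q_i,$$ (where a rectangle with $0$ rows or $0$ columns is $\emptyset$), which for fixed nonzero $q_1,\dots,q_\rho$ is an isomorphism of tori $(\mathbb{C}^* )^{\dim \mathrm{Fl}(n;r_1,\dots,r_\rho)}\to(\mathbb{C}^* )^{\dim \mathrm{Fl}(n;r_1,\dots,r_\rho)}$,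 satisfies $$\phi^*(W_T)=W_R .$$
   Context: Conventions. $\mathrm{Gr}(N,k)$ is the Grassmannian of $k$-dimensional quotients of $\mathbb{C}^N$. $S(N,r)$ is the set of partitions whose Young diagram fits in an $r\times(N-r)$ box ($r$ rows, $N-r$ columns). The rectangular partition with $a$ rows and $b$ columns is denoted $a\times b$; if $a=0$ or $b=0$ it is $\emptyset$. $M(N,r)\subset S(N,r)$ is the set of the $N$ rectangles that are maximally tall or maximally wide: $r\times a$ for $0\le a<N-r$, and $a\times(N-r)$ for $1\le a\le r$. $\square$ denotes the partition with one box, and $1^k$ the partition consisting of a single column of $k$ boxes ($1^0=\emptyset$). Put $m_i:=r_{i-1}-r_i$. Plücker coordinates. The Plücker coordinates of $\mathrm{Gr}(N,N-r)$ are indexed by $\lambda\in S(N,r)$: the lower-right boundary of $\lambda$, read as a lattice path from the bottom left to the top right corner of the $r\times(N-r)$ box, has $N$ steps, and the positions of its $N-r$ horizontal steps form an $(N-r)$-subset $J_\lambda$ of $\{1,\dots,N\}$; $p_\lambda$ is the maximal minor with columns $J_\lambda$ of an $(N-r)\times N$ matrix representing the point. On $Y=\prod_{i=1}^\rho \mathrm{Gr}(r_{i-1},r_{i-1}-r_i)$, $p^i_\lambda$ ($\lambda\in S(r_{i-1},r_i)$) denotes the Plücker coordinate $p_\lambda$ of the $i$-th factor. All Plücker coordinates are normalized by $p^i_\emptyset=1$. Plücker coordinate superpotential. Schubert classes $s_{\underline\mu}$ in the small quantum cohomology of $\mathrm{Fl}(n;r_1,\dots,r_\rho)$ are indexed by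 tuples $\underline\mu=(\mu_1,\dots,\mu_\rho)$ with $\mu_i\in S(r_{i-1},r_i)$; $s^i_\lambda$ is the class with $\mu_i=\lambda$ and all other $\mu_j=\emptyset$. To $s_{\underline\mu}$ one associates $p_{\underline\mu}=\prod_i p^i_{\mu_i}$. For $\lambda\in M(r_{i-1},r_i)$, $G^i_\lambda$ is obtained from the expansion of the quantum product $s^i_\square * s^i_\lambda$ in Schubert classes (with coefficients in $\mathbb{Z}[q_1,\dots,q_\rho]$) by replacing each $s_{\underline\mu}$ by $p_{\underline\mu}$. By the quantum Pieri rule, this is explicitly as follows, with the conventions $p^0_\square:=0$ and $p^{\rho+1}_\emptyset:=1$: (1) for $0\le a<m_i$: $G^i_{r_i\times a}=p^i_{(a+1,a,\dots,a)}$, the partition having $r_i$ parts; (2) for $1\le a<r_i-r_{i+1}$ : $G^i_{a\times m_i}=p^i_{(m_i,\dots,m_i,1)}+p^{i-1}_\square\,p^i_{a\times m_i}$, the first partition having $a$ parts equal to $m_i$ followed by one part $1$; (3) for $r_i-r_{i+1}\le a<r_i$: $G^i_{a\times m_i}=p^i_{(m_i,\dots,m_i,1)}+p^{i-1}_\square\,p^i_{a\times m_i}+q_i\,p^i_{(a-1)\times(m_i-1)}\,p^{i+1}_{1^{a-(r_i-r_{i+1})}}$, the first partition again having $a$ parts equal to $m_i$ and one part $1$; (4) for $a=r_i$: $G^i_{r_i\times m_i}=p^{i-1}_\square\,p^i_{r_i\times m_i}+q_i\,p^i_{(r_i-1)\times(m_i-1)}\,p^{i+1}_{1^{r_{i+1}}}$.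 The Plücker coordinate superpotential is $$W_P=\sum_{i=1}^{\rho}\Big(\sum_{\lambda\in M(r_{i-1},r_i)}\frac{G^i_\lambda}{p^i_\lambda}-r_{i+1}\,p^i_\square\Big),$$ a regular function on $Y^\circ\times\mathbb{C}^\rho$, where $Y^\circ\subset Y$ is the locus where $p^i_\emptyset=1$ can be imposed and $p^i_\lambda\ne0$ for all $i$ and all $\lambda\in M(r_{i-1},r_i)$, and $q_1,\dots,q_\rho$ are the coordinates on $\mathbb{C}^\rho$. Rectangles cluster chart. The rectangular Plücker coordinates $p^i_{a\times b}$ ($1\le a\le r_i$, $1\le b\le m_i$, $1\le i\le\rho$; $p^i_\emptyset=1$) are the coordinates of an open torus $(\mathbb{C}^* )^{\sum_i r_im_i}\hookrightarrow Y^\circ$, namely the locus where all of them are nonzero, and every Plücker coordinate $p^i_\lambda$ restricts to a Laurent polynomial in them. $W_R$ is the restriction of $W_P$ to this torus. Note $\sum_i r_im_i=\dim\mathrm{Fl}(n;r_1,\dots,r_\rho)$. Batyrev--Ciocan-Fontanine--Kim--van Straten mirror. The ladder diagram consists of $\rho$ blocks placed side by side from left to right, aligned along their bottom rows; block $i$ is a grid with $r_i$ rows and $m_i$ columns. Its quiver has one internal vertex for each box, the box in row $a$ (counted from the top) and column $b$ (counted from the left) of block $i$ carrying the variable $z^i_{a,b}$. There are $\rho+1$ external vertices $e_0,\dots,e_\rho$: for $1\le i\le\rho$, $e_{i-1}$ lies directly above the first column of block $i$ (for $i\ge2$ this is also directly to the right of the box in row $r_{i-1}-r_i$ and last column of block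 $i-1$), and $e_\rho$ lies directly to the right of the bottom row of block $\rho$. The vertex $e_0$ carries the value $\tilde q_0:=1$ and $e_i$ carries $\tilde q_i$. There is an arrow from each vertex to the vertex immediately to its right and to the vertex immediately below it, whenever such a vertex exists (including arrows between boxes of adjacent blocks in the same row). Writing $z_v$ for the variable or value carried by the vertex $v$, $$W_T=\sum_{\text{arrows } \alpha}\frac{z_{h(\alpha)}}{z_{t(\alpha)}},$$ where $h(\alpha)$ and $t(\alpha)$ are the head and tail of $\alpha$. *)

theory Defs
  imports Complex_Main "HOL-Library.FuncSet"
    "Jordan_Normal_Form.Determinant" "Jordan_Normal_Form.DL_Rank"
    "Jordan_Normal_Form.DL_Submatrix"
begin

text \<open>
  Throughout, a sequence \<open>r :: nat \<Rightarrow> nat\<close> with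
  \<open>r 0 > r 1 > \<dots> > r \<rho> > r (\<rho> + 1) = 0\<close> encodes the type of the flag variety
  \<open>Fl(r 0; r 1, \<dots>, r \<rho>)\<close>, and \<open>q 1, \<dots>, q \<rho>\<close> are the only relevant values of a
  parameter function \<open>q :: nat \<Rightarrow> complex\<close>.
\<close>

definition m :: "(nat \<Rightarrow> nat) \<Rightarrow> nat \<Rightarrow> nat" where
  "m r i = r (i - 1) - r i"


section \<open>Partitions\<close>

text \<open>
  A partition is the function sending \<open>j\<close> to its part number \<open>j + 1\<close>, continued by zeros.
  Hence trailing zero parts are invisible, and \<open>rect a 0 = rect 0 b\<close> is the empty partition.
\<close>

type_synonym partition = "nat \<Rightarrow> nat"

definition rect :: "nat \<Rightarrow> nat \<Rightarrow> partition" where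
  "rect a b = (\<lambda>j. if j < a then b else 0)"

definition empty_part :: partition where
  "empty_part = (\<lambda>_. 0)"

definition box :: partition where
  "box = rect 1 1"

definition column :: "nat \<Rightarrow> partition" where
  "column k = rect k 1"

text \<open>\<open>(a + 1, a, \<dots>, a)\<close> with \<open>k\<close> parts (\<open>k \<ge> 1\<close>)\<close>

definition rect_extra_col :: "nat \<Rightarrow> nat \<Rightarrow> partition" where
  "rect_extra_col k a = (\<lambda>j. if j = 0 then a + 1 else if j < k then a else 0)"

text \<open>\<open>(b, \<dots>, b, 1)\<close> with \<open>a\<close> parts equal to \<open>b\<close>\<close>

definition rect_extra_row :: "nat \<Rightarrow> nat \<Rightarrow> partition" where
  "rect_extra_row a b = (\<lambda>j. if j < a then b else if j = a then 1 else 0)"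

text \<open>
  The sizes \<open>(a, b)\<close> of the \<open>N\<close> maximally tall or maximally wide rectangles in the
  \<open>k \<times> (N - k)\<close> box; for \<open>0 < k < N\<close> distinct sizes give distinct partitions.
\<close>

definition max_rects :: "nat \<Rightarrow> nat \<Rightarrow> (nat \<times> nat) set" where
  "max_rects N k = {(k, b) |b. b < N - k} \<union> {(a, N - k) |a. 1 \<le> a \<and> a \<le> k}"


section \<open>Grassmannians and Pluecker coordinates\<close>

text \<open>
  A \<open>k\<close>-dimensional quotient of \<open>\<complex>\<^sup>N\<close> is the class of a full rank \<open>k \<times> N\<close> matrix up to
  the action of \<open>GL\<^sub>k\<close> on the left.
\<close>

definition full_rank_mats :: "nat \<Rightarrow> nat \<Rightarrow> complex mat set" where
  "full_rank_mats N k = {A \<in> carrier_mat k N. vec_space.rank k A = k}"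

definition row_equiv :: "nat \<Rightarrow> nat \<Rightarrow> (complex mat \<times> complex mat) set" where
  "row_equiv N k = {(A, B). A \<in> full_rank_mats N k \<and> B \<in> full_rank_mats N k \<and>
     (\<exists>P \<in> carrier_mat k k. invertible_mat P \<and> B = P * A)}"

definition Gr :: "nat \<Rightarrow> nat \<Rightarrow> complex mat set set" where
  "Gr N k = full_rank_mats N k // row_equiv N k"

text \<open>
  The positions in \<open>{1..N}\<close> of the horizontal steps of the boundary path of \<open>\<mu>\<close>, from the
  bottom left to the top right corner of the \<open>k \<times> (N - k)\<close> box: the horizontal step in
  column \<open>c\<close> comes after \<open>c - 1\<close> horizontal steps and after the vertical steps along those
  rows whose part is smaller than \<open>c\<close>.
\<close>

definition horizontal_steps :: "nat \<Rightarrow> nat \<Rightarrow> partition \<Rightarrow> nat set" where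
  "horizontal_steps N k \<mu> = (\<lambda>c. c + card {j. j < k \<and> \<mu> j < c}) ` {1..N - k}"

text \<open>The maximal minor of an \<open>(N - k) \<times> N\<close> matrix; the columns of \<^typ>\<open>'a mat\<close> count from 0.\<close>

definition maximal_minor :: "nat \<Rightarrow> nat \<Rightarrow> complex mat \<Rightarrow> partition \<Rightarrow> complex" where
  "maximal_minor N k A \<mu> = det (submatrix A UNIV {j. Suc j \<in> horizontal_steps N k \<mu>})"

text \<open>
  Pluecker coordinates of a point of \<open>Gr N (N - k)\<close>, normalized to be 1 at the empty
  partition; this does not depend on the choice of the representing matrix.
\<close>

definition pluecker :: "nat \<Rightarrow> nat \<Rightarrow> complex mat set \<Rightarrow> partition \<Rightarrow> complex" where
  "pluecker N k X \<mu> = (let A = (SOME A. A \<in> X)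
     in maximal_minor N k A \<mu> / maximal_minor N k A empty_part)"

definition Y :: "nat \<Rightarrow> (nat \<Rightarrow> nat) \<Rightarrow> (nat \<Rightarrow> complex mat set) set" where
  "Y \<rho> r = (\<Pi>\<^sub>E i\<in>{1..\<rho>}. Gr (r (i - 1)) (m r i))"

text \<open>
  \<open>p\<^sup>i\<^sub>\<mu>\<close> on \<open>Y\<close>. Outside \<open>1 \<le> i \<le> \<rho>\<close> only \<open>p\<^sup>0\<close> at the box and \<open>p\<^sup>\<rho>\<^sup>+\<^sup>1\<close> at the empty
  partition ever occur, with conventional values 0 and 1.
\<close>

definition p :: "nat \<Rightarrow> (nat \<Rightarrow> nat) \<Rightarrow> (nat \<Rightarrow> complex mat set) \<Rightarrow> nat \<Rightarrow> partition \<Rightarrow> complex" where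
  "p \<rho> r y i \<mu> = (if i = 0 then 0 else if i > \<rho> then 1 else pluecker (r (i - 1)) (r i) (y i) \<mu>)"

definition Y_open :: "nat \<Rightarrow> (nat \<Rightarrow> nat) \<Rightarrow> (nat \<Rightarrow> complex mat set) set" where
  "Y_open \<rho> r = {y \<in> Y \<rho> r. \<forall>i\<in>{1..\<rho>}.
     (\<forall>A\<in>y i. maximal_minor (r (i - 1)) (r i) A empty_part \<noteq> 0) \<and>
     (\<forall>(a, b)\<in>max_rects (r (i - 1)) (r i). p \<rho> r y i (rect a b) \<noteq> 0)}"


section \<open>The Pluecker coordinate superpotential\<close>

text \<open>
  \<open>G \<rho> r q y i (a, b)\<close> is the image of the quantum product of \<open>s\<^sup>i\<close> at the box and \<open>s\<^sup>i\<close> at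
  the \<open>a \<times> b\<close> rectangle, expanded by the quantum Pieri rule, for
  \<open>(a, b) \<in> max_rects (r (i - 1)) (r i)\<close>. If \<open>b < m r i\<close> then \<open>a = r i\<close>; otherwise \<open>b = m r i\<close>.
\<close>

definition G :: "nat \<Rightarrow> (nat \<Rightarrow> nat) \<Rightarrow> (nat \<Rightarrow> complex) \<Rightarrow> (nat \<Rightarrow> complex mat set)
    \<Rightarrow> nat \<Rightarrow> nat \<times> nat \<Rightarrow> complex" where
  "G \<rho> r q y i = (\<lambda>(a, b).
     let p' = p \<rho> r y; d = r i - r (i + 1) in
     if b < m r i then p' i (rect_extra_col (r i) b)
     else if a < d then
       p' i (rect_extra_row a (m r i)) + p' (i - 1) box * p' i (rect a (m r i))
     else if a < r i then
       p' i (rect_extra_row a (m r i)) + p' (i - 1) box * p' i (rect a (m r i))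
         + q i * p' i (rect (a - 1) (m r i - 1)) * p' (i + 1) (column (a - d))
     else
       p' (i - 1) box * p' i (rect (r i) (m r i))
         + q i * p' i (rect (r i - 1) (m r i - 1)) * p' (i + 1) (column (r (i + 1))))"

definition W_P :: "nat \<Rightarrow> (nat \<Rightarrow> nat) \<Rightarrow> (nat \<Rightarrow> complex) \<Rightarrow> (nat \<Rightarrow> complex mat set) \<Rightarrow> complex" where
  "W_P \<rho> r q y = (\<Sum>i = 1..\<rho>.
     (\<Sum>(a, b)\<in>max_rects (r (i - 1)) (r i). G \<rho> r q y i (a, b) / p \<rho> r y i (rect a b))
     - of_nat (r (i + 1)) * p \<rho> r y i box)"


section \<open>Tori\<close>

definition torus :: "'k set \<Rightarrow> ('k \<Rightarrow> complex) set" where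
  "torus I = I \<rightarrow>\<^sub>E (UNIV - {0})"

definition laurent_on_torus :: "'k set \<Rightarrow> (('k \<Rightarrow> complex) \<Rightarrow> complex) \<Rightarrow> bool" where
  "laurent_on_torus I f \<longleftrightarrow> (\<exists>(E :: ('k \<Rightarrow> int) set) c. finite E \<and>
     (\<forall>x\<in>torus I. f x = (\<Sum>e\<in>E. c e * (\<Prod>k\<in>I. x k powi e k))))"

text \<open>
  Isomorphism of tori as algebraic varieties (it need not preserve the unit): a bijection
  which is regular in both directions, the regular functions on a torus being the Laurent
  polynomials.
\<close>

definition torus_iso :: "'k set \<Rightarrow> 'l set \<Rightarrow> (('k \<Rightarrow> complex) \<Rightarrow> ('l \<Rightarrow> complex)) \<Rightarrow> bool" where
  "torus_iso I J f \<longleftrightarrow> bij_betw f (torus I) (torus J) \<and>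
     (\<forall>l\<in>J. laurent_on_torus I (\<lambda>x. f x l)) \<and>
     (\<forall>k\<in>I. laurent_on_torus J (\<lambda>z. the_inv_into (torus I) f z k))"

text \<open>
  \<open>W\<close> is a Laurent polynomial in the torus coordinates with coefficients in
  \<open>\<int>[q 1, \<dots>, q \<rho>]\<close>; the values of \<open>q\<close> may vanish.
\<close>

definition laurent_over_int_q ::
    "nat \<Rightarrow> 'k set \<Rightarrow> ((nat \<Rightarrow> complex) \<Rightarrow> ('k \<Rightarrow> complex) \<Rightarrow> complex) \<Rightarrow> bool" where
  "laurent_over_int_q \<rho> I W \<longleftrightarrow>
     (\<exists>(E :: ((nat \<Rightarrow> nat) \<times> ('k \<Rightarrow> int)) set) (c :: (nat \<Rightarrow> nat) \<times> ('k \<Rightarrow> int) \<Rightarrow> int). finite E \<and>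
       (\<forall>q. \<forall>x\<in>torus I. W q x =
          (\<Sum>(d, e)\<in>E. of_int (c (d, e)) * (\<Prod>j = 1..\<rho>. q j ^ d j) * (\<Prod>k\<in>I. x k powi e k))))"


section \<open>The rectangles cluster chart\<close>

text \<open>The triples \<open>(i, a, b)\<close> indexing both \<open>p\<^sup>i\<close> at \<open>a \<times> b\<close> and the box variables of the ladder diagram\<close>

definition indices :: "nat \<Rightarrow> (nat \<Rightarrow> nat) \<Rightarrow> (nat \<times> nat \<times> nat) set" where
  "indices \<rho> r = {(i, a, b). 1 \<le> i \<and> i \<le> \<rho> \<and> 1 \<le> a \<and> a \<le> r i \<and> 1 \<le> b \<and> b \<le> m r i}"

definition rect_locus :: "nat \<Rightarrow> (nat \<Rightarrow> nat) \<Rightarrow> (nat \<Rightarrow> complex mat set) set" where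
  "rect_locus \<rho> r = {y \<in> Y_open \<rho> r. \<forall>(i, a, b)\<in>indices \<rho> r. p \<rho> r y i (rect a b) \<noteq> 0}"

definition rect_coords ::
    "nat \<Rightarrow> (nat \<Rightarrow> nat) \<Rightarrow> (nat \<Rightarrow> complex mat set) \<Rightarrow> (nat \<times> nat \<times> nat \<Rightarrow> complex)" where
  "rect_coords \<rho> r y = (\<lambda>(i, a, b)\<in>indices \<rho> r. p \<rho> r y i (rect a b))"

definition rect_chart ::
    "nat \<Rightarrow> (nat \<Rightarrow> nat) \<Rightarrow> (nat \<times> nat \<times> nat \<Rightarrow> complex) \<Rightarrow> (nat \<Rightarrow> complex mat set)" where
  "rect_chart \<rho> r = the_inv_into (rect_locus \<rho> r) (rect_coords \<rho> r)"

definition W_R :: "nat \<Rightarrow> (nat \<Rightarrow> nat) \<Rightarrow> (nat \<Rightarrow> complex) \<Rightarrow> (nat \<times> nat \<times> nat \<Rightarrow> complex) \<Rightarrow> complex" where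
  "W_R \<rho> r q x = W_P \<rho> r q (rect_chart \<rho> r x)"


section \<open>The mirror of Batyrev, Ciocan-Fontanine, Kim and van Straten\<close>

datatype vertex = Box nat nat nat | Ext nat

definition vertices :: "nat \<Rightarrow> (nat \<Rightarrow> nat) \<Rightarrow> vertex set" where
  "vertices \<rho> r = {Box i a b |i a b. (i, a, b) \<in> indices \<rho> r} \<union> {Ext i |i. i \<le> \<rho>}"

text \<open>
  Position (column, row) in the plane, columns counted from the left and rows from the top.
  The blocks left of block \<open>i\<close> have \<open>r 0 - r (i - 1)\<close> columns in total, and the bottom row
  of every block is row \<open>r 0\<close>. For \<open>i < \<rho>\<close>, \<open>Ext i\<close> lies directly above the first column of
  block \<open>i + 1\<close>; for \<open>i = \<rho>\<close> the same formula gives, because of \<open>r (\<rho> + 1) = 0\<close>, the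
  position right of the bottom row of block \<open>\<rho>\<close>.
\<close>

fun position :: "(nat \<Rightarrow> nat) \<Rightarrow> vertex \<Rightarrow> nat \<times> nat" where
  "position r (Box i a b) = (r 0 - r (i - 1) + b, r 0 - r i + a)"
| "position r (Ext i) = (r 0 - r i + 1, r 0 - r (i + 1))"

text \<open>Arrows as pairs (tail, head)\<close>

definition arrows :: "nat \<Rightarrow> (nat \<Rightarrow> nat) \<Rightarrow> (vertex \<times> vertex) set" where
  "arrows \<rho> r = {(t, h). t \<in> vertices \<rho> r \<and> h \<in> vertices \<rho> r \<and>
     (position r h = (fst (position r t) + 1, snd (position r t)) \<or>
      position r h = (fst (position r t), snd (position r t) + 1))}"

fun vertex_value :: "(nat \<Rightarrow> complex) \<Rightarrow> (nat \<times> nat \<times> nat \<Rightarrow> complex) \<Rightarrow> vertex \<Rightarrow> complex" where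
  "vertex_value qt z (Box i a b) = z (i, a, b)"
| "vertex_value qt z (Ext i) = (if i = 0 then 1 else qt i)"

definition W_T :: "nat \<Rightarrow> (nat \<Rightarrow> nat) \<Rightarrow> (nat \<Rightarrow> complex) \<Rightarrow> (nat \<times> nat \<times> nat \<Rightarrow> complex) \<Rightarrow> complex" where
  "W_T \<rho> r qt z = (\<Sum>(t, h)\<in>arrows \<rho> r. vertex_value qt z h / vertex_value qt z t)"


section \<open>The change of variables\<close>

definition phi_q :: "(nat \<Rightarrow> complex) \<Rightarrow> nat \<Rightarrow> complex" where
  "phi_q q i = (\<Prod>j = 1..i. q j)"

definition phi_z :: "nat \<Rightarrow> (nat \<Rightarrow> nat) \<Rightarrow> (nat \<Rightarrow> complex)
    \<Rightarrow> (nat \<times> nat \<times> nat \<Rightarrow> complex) \<Rightarrow> (nat \<times> nat \<times> nat \<Rightarrow> complex)" where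
  "phi_z \<rho> r q x = (\<lambda>(i, a, b)\<in>indices \<rho> r.
     (\<Prod>j = 1..i - 1. q j) * x (i, a, b) / (if a = 1 \<or> b = 1 then 1 else x (i, a - 1, b - 1)))"

end

(*
  Up to the row action, a point of the chart p_empty = 1 is a matrix [B | I]. Its rectangular
  coordinate p_{a x b} is the determinant of b consecutive columns in the first b rows, and it is
  linear in the lower left entry of B in that window, with coefficient +- p_{(a-1) x (b-1)}.
  So on the torus B is recovered entry by entry, in the order of increasing a + b.

  Dividing the three-term Pluecker relations by p_{a x b} p_{(a-1) x b}, respectively by
  p_{a x b} p_{a x (b-1)}, makes the quotients p_{(b+1,b,...,b)} / p_{a x b} and
  p_{(b,...,b,1)} / p_{a x b} telescope; the increments are exactly the ratios z_h / z_t on the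
  horizontal, respectively vertical, arrows inside a block. The q-terms correspond to the arrows
  leaving a block through its last column, and the terms with p^{i-1}_box cancel against
  r_{i+1} p^i_box in the sum over i.
*)
theory Submission
  imports Defs "Jordan_Normal_Form.DL_Rank_Submatrix"
begin

section \<open>Three-term Pluecker relations\<close>

text \<open>\<open>W_R\<close> is defined through \<open>rect_chart\<close>, the inverse of
  \<open>rect_coords\<close>. So the coordinates have to be shown bijective onto the torus before
  \<open>W_R\<close> can be evaluated at a point of the torus. Each telescoping starts at a
  partition with an extra box that is itself a rectangle: (b+1) has one row and (1,...,1) one
  column. The sums therefore have no leftover boundary term. The arrow out of the external vertex
  above block i is matched by the empty rectangle, whose contribution is p_box / p_empty. The
  prefactor q_1...q_{i-1} of the change of variables is constant on block i and equals the value of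
  the external vertex above it. It cancels on arrows inside the block and on the arrow entering it;
  an arrow leaving block i through its last column keeps exactly the factor q_i, whether it ends in
  block i+1 or at \<open>Ext i\<close>. Rectangles with an empty side occur at every border of these
  formulas. They are treated uniformly by giving them the value 1.\<close>

definition cdet :: "(nat \<Rightarrow> nat \<Rightarrow> 'a :: field) \<Rightarrow> nat list \<Rightarrow> 'a" where
  "cdet F xs = det (mat (length xs) (length xs) (\<lambda>(i, j). F i (xs ! j)))"

lemma cdet_swap: "cdet F (xs @ u # v # ys) = - cdet F (xs @ v # u # ys)"
proof -
  let ?d = "length (xs @ v # u # ys)" and ?l = "length xs"
  let ?M = "mat ?d ?d (\<lambda>(i, j). F i ((xs @ v # u # ys) ! j))"
  have "mat ?d ?d (\<lambda>(i, j). F i ((xs @ u # v # ys) ! j)) = swapcols ?l (Suc ?l) ?M"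
    by (rule eq_matI) (auto simp: mat_swapcols_def nth_append nth_Cons' Suc_diff_Suc split: if_splits)
  moreover have "det (swapcols ?l (Suc ?l) ?M) = - det ?M"
    by (rule det_swapcols[where n = ?d]) auto
  ultimately show ?thesis
    by (simp add: cdet_def)
qed

text \<open>Columns form a list, not a set, so bringing one forward is a chain of adjacent swaps
  whose sign is explicit. This brings minors with interleaved columns into the shape of
  \<open>plucker_three_term\<close>.\<close>

lemma cdet_move: "cdet F (xs @ S @ u # ys) = (-1) ^ length S * cdet F (xs @ u # S @ ys)"
proof (induction S arbitrary: xs)
  case (Cons s S)
  have "cdet F (xs @ (s # S) @ u # ys) = cdet F ((xs @ [s]) @ S @ u # ys)"
    by simp
  also have "\<dots> = (-1) ^ length S * cdet F (xs @ s # u # S @ ys)"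
    by (subst Cons.IH) simp
  also have "\<dots> = (-1) ^ length (s # S) * cdet F (xs @ u # (s # S) @ ys)"
    by (subst cdet_swap) simp
  finally show ?case .
qed simp

lemma cdet_repeat:
  assumes "j < length xs" "j' < length xs" "j \<noteq> j'" "xs ! j = xs ! j'"
  shows "cdet F xs = 0"
  unfolding cdet_def using assms
  by (intro det_identical_columns[of _ "length xs" j j']) (auto intro!: eq_vecI)

text \<open>Expand along the first row of the square matrix obtained by doubling row \<open>i\<close>.\<close>

lemma cdet_syzygy:
  assumes len: "length vs = Suc d" and i: "i < d"
  shows "(\<Sum>j<Suc d. (-1) ^ j * F i (vs ! j) * cdet F (take j vs @ drop (Suc j) vs)) = 0"
proof -
  define M where "M = mat (Suc d) (Suc d) (\<lambda>(i', j). F (if i' = 0 then i else i' - 1) (vs ! j))"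
  have M: "M \<in> carrier_mat (Suc d) (Suc d)"
    by (simp add: M_def)
  have del: "mat_delete M 0 j = mat d d (\<lambda>(i', j'). F i' ((take j vs @ drop (Suc j) vs) ! j'))"
    if "j < Suc d" for j
    using that len by (intro eq_matI) (auto simp: M_def mat_delete_def nth_append)
  have "0 = det M"
    by (rule det_identical_rows[OF M, of 0 "Suc i", symmetric])
      (use i in \<open>auto simp: M_def intro!: eq_vecI\<close>)
  also have "\<dots> = (\<Sum>j<Suc d. M $$ (0, j) * cofactor M 0 j)"
    by (rule laplace_expansion_row[OF M]) simp
  also have "\<dots> = (\<Sum>j<Suc d. (-1) ^ j * F i (vs ! j) * cdet F (take j vs @ drop (Suc j) vs))"
    using len by (intro sum.cong) (auto simp: cofactor_def del cdet_def, auto simp: M_def min_def)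
  finally show ?thesis ..
qed

text \<open>The minor \<open>cdet F (v # z # L)\<close> is linear in the column v, with coefficients
  \<open>C i\<close> independent of v. Weighting the syzygies of the columns
  \<open>w # x # y # L\<close> by \<open>C i\<close> and summing over i gives an alternating sum of
  products. When v comes from L, the second factor has a repeated column, so only v = w, x, y
  survive.\<close>

lemma plucker_three_term:
  "cdet F (w # y # L) * cdet F (x # z # L) =
     cdet F (w # z # L) * cdet F (x # y # L) + cdet F (w # x # L) * cdet F (y # z # L)"
proof -
  define d where "d = Suc (Suc (length L))"
  \<comment> \<open>The leading \<open>0\<close> in the column list is a placeholder: the cofactor
    deletes that column.\<close>
  define C where "C i = cofactor (mat d d (\<lambda>(i, j). F i ((0 # z # L) ! j))) i 0" for i
  have expand: "cdet F (v # z # L) = (\<Sum>i<d. F i v * C i)" for v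
  proof -
    let ?M = "mat d d (\<lambda>(i, j). F i ((v # z # L) ! j))"
    have "cdet F (v # z # L) = (\<Sum>i<d. ?M $$ (i, 0) * cofactor ?M i 0)"
      unfolding cdet_def by (subst laplace_expansion_column[where j = 0 and n = d]) (auto simp: d_def)
    moreover have "mat_delete ?M i 0 = mat_delete (mat d d (\<lambda>(i, j). F i ((0 # z # L) ! j))) i 0" for i
      by (rule eq_matI) (auto simp: mat_delete_def)
    ultimately show ?thesis
      by (auto simp: C_def cofactor_def d_def intro!: sum.cong)
  qed
  define vs where "vs = w # x # y # L"
  have len: "length vs = Suc d"
    by (simp add: vs_def d_def)
  have "0 = (\<Sum>i<d. (\<Sum>j<Suc d. (-1) ^ j * F i (vs ! j) * cdet F (take j vs @ drop (Suc j) vs)) * C i)"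
    by (intro sum.neutral[symmetric] ballI) (simp add: cdet_syzygy[OF len] del: sum.lessThan_Suc)
  also have "\<dots> = (\<Sum>j<Suc d. \<Sum>i<d. (-1) ^ j * cdet F (take j vs @ drop (Suc j) vs) * (F i (vs ! j) * C i))"
    unfolding sum_distrib_right by (subst sum.swap) (simp add: mult_ac)
  also have "\<dots> = (\<Sum>j<Suc d. (-1) ^ j * cdet F (take j vs @ drop (Suc j) vs) * cdet F (vs ! j # z # L))"
    by (simp only: expand sum_distrib_left)
  also have "\<dots> = cdet F (x # y # L) * cdet F (w # z # L) - cdet F (w # y # L) * cdet F (x # z # L)
      + cdet F (w # x # L) * cdet F (y # z # L)
      + (\<Sum>j<length L. (-1) ^ (j + 3) * cdet F (take (j + 3) vs @ drop (Suc (j + 3)) vs) * cdet F (L ! j # z # L))"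
    by (simp add: d_def sum.lessThan_Suc_shift vs_def numeral_3_eq_3 del: sum.lessThan_Suc)
  also have "(\<Sum>j<length L. (-1) ^ (j + 3) * cdet F (take (j + 3) vs @ drop (Suc (j + 3)) vs) * cdet F (L ! j # z # L)) = 0"
  proof (intro sum.neutral ballI)
    fix j assume "j \<in> {..<length L}"
    then have "cdet F (L ! j # z # L) = 0"
      by (intro cdet_repeat[of 0 _ "j + 2"]) auto
    then show "(-1) ^ (j + 3) * cdet F (take (j + 3) vs @ drop (Suc (j + 3)) vs) * cdet F (L ! j # z # L) = 0"
      by simp
  qed
  finally show ?thesis
    by (simp add: algebra_simps)
qed

section \<open>Minors indexed by partitions\<close>

definition hpos :: "nat \<Rightarrow> partition \<Rightarrow> nat \<Rightarrow> nat" where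
  "hpos k \<mu> c = c + card {j. j < k \<and> \<mu> j \<le> c}"

lemma hpos_strict_mono: "strict_mono (hpos k \<mu>)"
proof (rule strict_monoI)
  fix x y :: nat assume "x < y"
  have "card {j. j < k \<and> \<mu> j \<le> x} \<le> card {j. j < k \<and> \<mu> j \<le> y}"
    using \<open>x < y\<close> by (intro card_mono) auto
  then show "hpos k \<mu> x < hpos k \<mu> y"
    using \<open>x < y\<close> by (simp add: hpos_def)
qed

lemma hpos_less: "c < d \<Longrightarrow> hpos k \<mu> c < k + d"
proof -
  assume "c < d"
  have "card {j. j < k \<and> \<mu> j \<le> c} \<le> card {..<k}"
    by (intro card_mono) auto
  then show ?thesis using \<open>c < d\<close> by (simp add: hpos_def)
qed

text \<open>\<open>submatrix\<close> addresses columns through \<open>pick\<close>, the increasing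
  enumeration of a set. An element of the image is identified by the number of elements below
  it.\<close>

lemma pick_strict_mono_image:
  fixes h :: "nat \<Rightarrow> nat"
  assumes h: "strict_mono h" and j: "j < d"
  shows "pick (h ` {..<d}) j = h j"
proof -
  have inj: "inj_on h X" for X
    using h by (simp add: strict_mono_imp_inj_on inj_on_subset)
  have card: "card (h ` {..<d}) = d"
    by (simp add: card_image inj)
  obtain j' where j': "j' < d" "pick (h ` {..<d}) j = h j'"
    using pick_in_set_le[of j "h ` {..<d}"] card j by auto
  have "{a \<in> h ` {..<d}. a < h j'} = h ` {..<j'}"
    using j'(1) strict_mono_less[OF h] by auto
  then have "j = card (h ` {..<j'})"
    using card_pick_le[of j "h ` {..<d}"] card j j'(2) by simp
  then show ?thesis
    using j'(2) by (simp add: card_image inj)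
qed

abbreviation minor :: "(nat \<Rightarrow> nat \<Rightarrow> 'a :: field) \<Rightarrow> nat \<Rightarrow> nat \<Rightarrow> partition \<Rightarrow> 'a" where
  "minor F k d \<mu> \<equiv> cdet F (map (hpos k \<mu>) [0..<d])"

text \<open>Both the columns of the box and the positions are shifted to start at 0, which turns the
  strict inequality of \<open>horizontal_steps\<close> into the \<open>\<le>\<close> of
  \<open>hpos\<close>.\<close>

lemma horizontal_steps_eq: "{j. Suc j \<in> horizontal_steps (k + d) k \<mu>} = hpos k \<mu> ` {..<d}"
proof -
  have "horizontal_steps (k + d) k \<mu> = (\<lambda>c. Suc c + card {j. j < k \<and> \<mu> j < Suc c}) ` {..<d}"
    unfolding horizontal_steps_def image_Suc_lessThan[symmetric] image_image by simp
  also have "\<dots> = Suc ` hpos k \<mu> ` {..<d}"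
    unfolding image_image hpos_def by (simp add: less_Suc_eq_le)
  finally show ?thesis
    by auto
qed

lemma submatrix_horizontal_steps:
  assumes A: "A \<in> carrier_mat d (k + d)"
  shows "submatrix A UNIV {j. Suc j \<in> horizontal_steps (k + d) k \<mu>} =
    mat d d (\<lambda>(i, j). A $$ (i, hpos k \<mu> j))"
proof -
  have "{j. j < k + d \<and> j \<in> hpos k \<mu> ` {..<d}} = hpos k \<mu> ` {..<d}"
    using hpos_less by auto
  moreover have "card (hpos k \<mu> ` {..<d}) = d"
    by (simp add: card_image strict_mono_imp_inj_on[OF hpos_strict_mono] inj_on_subset[of _ UNIV])
  ultimately show ?thesis
    using A unfolding submatrix_def horizontal_steps_eq
    by (auto simp: pick_UNIV pick_strict_mono_image[OF hpos_strict_mono] intro!: eq_matI)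
qed

lemma maximal_minor_eq:
  assumes A: "A \<in> carrier_mat d (k + d)"
  shows "maximal_minor (k + d) k A \<mu> = minor (\<lambda>i j. A $$ (i, j)) k d \<mu>"
  unfolding maximal_minor_def submatrix_horizontal_steps[OF A] cdet_def
  by (auto intro!: arg_cong[of _ _ det])

text \<open>The first b horizontal steps come after the k - a rows with part 0, the later ones after
  all k rows. So p_{a x b} uses the columns k-a, ..., k-a+b-1 and k+b, ..., k+d-1.\<close>

lemma hpos_rect: "a \<le> k \<Longrightarrow> hpos k (rect a b) c = c + (if c < b then k - a else k)"
proof -
  assume "a \<le> k"
  have "{j. j < k \<and> rect a b j \<le> c} = (if c < b then {a..<k} else {..<k})"
    by (auto simp: rect_def)
  then show ?thesis
    using \<open>a \<le> k\<close> by (simp add: hpos_def)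
qed

lemma hpos_rect_extra_col:
  assumes "1 \<le> a" "a \<le> k"
  shows "hpos k (rect_extra_col a b) c = c + (if c < b then k - a else if c = b then k - 1 else k)"
proof -
  have "{j. j < k \<and> rect_extra_col a b j \<le> c} =
      (if c < b then {a..<k} else if c = b then {1..<k} else {..<k})"
    using assms by (auto simp: rect_extra_col_def)
  then show ?thesis
    using assms by (simp add: hpos_def)
qed

lemma hpos_rect_extra_row:
  assumes "a < k" "1 \<le> b"
  shows "hpos k (rect_extra_row a b) c = c + (if c = 0 then k - a - 1 else if c < b then k - a else k)"
proof -
  have "{j. j < k \<and> rect_extra_row a b j \<le> c} =
      (if c = 0 then {Suc a..<k} else if c < b then {a..<k} else {..<k})"
    using assms by (auto simp: rect_extra_row_def)
  then show ?thesis
    using assms by (simp add: hpos_def)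
qed

text \<open>All six minors contain the columns in S and T; the two remaining columns run through the
  pairs of the three-term relation on w, x, y, z. In each of the three products exactly one factor
  has S between its two special columns, so the sign (-1)^|S| is common to all of them.\<close>

lemma plucker_extra_col:
  assumes a: "2 \<le> a" "a \<le> k" and b: "1 \<le> b" "b < d"
  shows "minor F k d (rect_extra_col a b) * minor F k d (rect (a - 1) b) =
    minor F k d (rect_extra_col (a - 1) b) * minor F k d (rect a b)
    + minor F k d (rect a (b + 1)) * minor F k d (rect (a - 1) (b - 1))"
proof -
  define w x y z where "w = k - a" "x = k - a + b" "y = k + b - 1" "z = k + b"
  define S where "S = [k - a + 1..<k - a + b]"
  define T where "T = [k + b + 1..<k + d]"
  have eqs:
    "map (hpos k (rect_extra_col a b)) [0..<d] = w # S @ y # T"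
    "map (hpos k (rect (a - 1) b)) [0..<d] = S @ x # z # T"
    "map (hpos k (rect_extra_col (a - 1) b)) [0..<d] = S @ x # y # T"
    "map (hpos k (rect a b)) [0..<d] = w # S @ z # T"
    "map (hpos k (rect a (b + 1))) [0..<d] = w # S @ x # T"
    "map (hpos k (rect (a - 1) (b - 1))) [0..<d] = S @ y # z # T"
    using a b by (auto intro!: nth_equalityI simp: w_x_y_z_def S_def T_def hpos_rect
        hpos_rect_extra_col nth_append nth_Cons')
  have one: "cdet F (u # S @ v # T) = (-1) ^ length S * cdet F (u # v # S @ T)" for u v
    using cdet_move[of F "[u]" S v T] by simp
  have two: "cdet F (S @ u # v # T) = cdet F (u # v # S @ T)" for u v
    using cdet_move[of F "[]" S u "v # T"] cdet_move[of F "[u]" S v T] by simp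
  show ?thesis
    unfolding eqs one two using plucker_three_term[of F w y "S @ T" x z]
    by (simp add: algebra_simps flip: distrib_left)
qed

text \<open>The same relation with other special columns. In the first two products both factors
  carry the sign (-1)^|S|, in the third neither does, so no sign remains.\<close>

lemma plucker_extra_row:
  assumes a: "1 \<le> a" "a < k" and b: "2 \<le> b" "b \<le> d"
  shows "minor F k d (rect_extra_row a b) * minor F k d (rect a (b - 1)) =
    minor F k d (rect_extra_row a (b - 1)) * minor F k d (rect a b)
    + minor F k d (rect (a + 1) b) * minor F k d (rect (a - 1) (b - 1))"
proof -
  define w x y z where "w = k - a - 1" "x = k - a" "y = k - a + b - 1" "z = k + b - 1"
  define S where "S = [k - a + 1..<k - a + b - 1]"
  define T where "T = [k + b..<k + d]"
  have eqs:
    "map (hpos k (rect_extra_row a b)) [0..<d] = w # S @ y # T"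
    "map (hpos k (rect a (b - 1))) [0..<d] = x # S @ z # T"
    "map (hpos k (rect_extra_row a (b - 1))) [0..<d] = w # S @ z # T"
    "map (hpos k (rect a b)) [0..<d] = x # S @ y # T"
    "map (hpos k (rect (a + 1) b)) [0..<d] = w # x # S @ T"
    "map (hpos k (rect (a - 1) (b - 1))) [0..<d] = S @ y # z # T"
    using a b by (auto intro!: nth_equalityI simp: w_x_y_z_def S_def T_def hpos_rect
        hpos_rect_extra_row nth_append nth_Cons')
  have one: "cdet F (u # S @ v # T) = (-1) ^ length S * cdet F (u # v # S @ T)" for u v
    using cdet_move[of F "[u]" S v T] by simp
  have two: "cdet F (S @ u # v # T) = cdet F (u # v # S @ T)" for u v
    using cdet_move[of F "[]" S u "v # T"] cdet_move[of F "[u]" S v T] by simp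
  show ?thesis
    unfolding eqs one two using plucker_three_term[of F w y "S @ T" x z]
    by (simp add: algebra_simps)
qed

section \<open>Normalized Pluecker coordinates\<close>

lemma rect_empty [simp]: "rect 0 b = empty_part" "rect a 0 = empty_part"
  by (auto simp: rect_def empty_part_def)

section \<open>Rank, row equivalence and independence of the representative\<close>

lemma (in vec_space) rank_le_nr:
  assumes "A \<in> carrier_mat n nc"
  shows "rank A \<le> n"
proof -
  have "set (cols A) \<subseteq> carrier_vec n"
    using assms cols_dim by blast
  then have "vectorspace.dim class_ring (span_vs (set (cols A))) \<le> dim"
    using subspace_dim[OF span_is_subspace fin_dim fin_dim_span_cols[OF assms]] by simp
  then show ?thesis
    unfolding rank_def dim_is_n .
qed

lemma full_rank_mats_minorI:
  assumes A: "A \<in> carrier_mat d (k + d)" and nz: "maximal_minor (k + d) k A \<mu> \<noteq> 0"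
  shows "A \<in> full_rank_mats (k + d) d"
proof -
  have "{j. j < k + d \<and> j \<in> hpos k \<mu> ` {..<d}} = hpos k \<mu> ` {..<d}"
    using hpos_less by auto
  moreover have "card (hpos k \<mu> ` {..<d}) = d"
    by (simp add: card_image strict_mono_imp_inj_on[OF hpos_strict_mono] inj_on_subset[of _ UNIV])
  ultimately have "d \<le> vec_space.rank d A"
    using vec_space.rank_gt_minor[OF A nz[unfolded maximal_minor_def]]
    by (simp add: horizontal_steps_eq)
  then show ?thesis
    using A vec_space.rank_le_nr[OF A] by (simp add: full_rank_mats_def)
qed

text \<open>Selecting columns commutes with multiplication from the left, so all maximal minors are
  scaled by the same factor.\<close>

lemma maximal_minor_mult:
  assumes P: "P \<in> carrier_mat d d" and A: "A \<in> carrier_mat d (k + d)"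
  shows "maximal_minor (k + d) k (P * A) \<mu> = det P * maximal_minor (k + d) k A \<mu>"
proof -
  have PA: "P * A \<in> carrier_mat d (k + d)"
    using P A by simp
  have "mat d d (\<lambda>(i, j). (P * A) $$ (i, hpos k \<mu> j)) = P * mat d d (\<lambda>(i, j). A $$ (i, hpos k \<mu> j))"
    using P A hpos_less[of _ d k \<mu>] by (intro eq_matI) (auto simp: scalar_prod_def)
  then show ?thesis
    unfolding maximal_minor_def submatrix_horizontal_steps[OF A] submatrix_horizontal_steps[OF PA]
    using det_mult[OF P] by simp
qed

lemma inverse_mat_exists:
  assumes A: "(A :: complex mat) \<in> carrier_mat d d" and nz: "det A \<noteq> 0"
  obtains P where "P \<in> carrier_mat d d" "P * A = 1\<^sub>m d" "A * P = 1\<^sub>m d"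
  using det_non_zero_imp_unit[OF A nz, of "()"] unfolding Units_def
  by (auto simp: ring_mat_def)

text \<open>\<open>invertible_mat\<close> does not fix the size of the inverse; it is recovered from
  the dimensions of the two products.\<close>

lemma invertible_mat_iff_inverse:
  assumes "P \<in> carrier_mat d d"
  shows "invertible_mat P \<longleftrightarrow> (\<exists>Q \<in> carrier_mat d d. P * Q = 1\<^sub>m d \<and> Q * P = 1\<^sub>m d)"
proof
  assume "invertible_mat P"
  then obtain Q where Q: "P * Q = 1\<^sub>m d" "Q * P = 1\<^sub>m (dim_row Q)"
    using assms by (auto simp: invertible_mat_def inverts_mat_def)
  have "dim_col Q = d"
    using Q(1) by (metis index_mult_mat(3) index_one_mat(3))
  moreover have "dim_row Q = d"
    using Q(2) assms by (metis carrier_matD(2) index_mult_mat(3) index_one_mat(3))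
  ultimately show "\<exists>Q \<in> carrier_mat d d. P * Q = 1\<^sub>m d \<and> Q * P = 1\<^sub>m d"
    using Q by auto
qed (use assms in \<open>auto simp: invertible_mat_def inverts_mat_def\<close>)

lemma invertible_mat_det:
  assumes P: "(P :: complex mat) \<in> carrier_mat d d" and "invertible_mat P"
  shows "det P \<noteq> 0"
proof -
  obtain Q where Q: "Q \<in> carrier_mat d d" "P * Q = 1\<^sub>m d"
    using assms invertible_mat_iff_inverse by blast
  then have "det P * det Q = 1"
    using det_mult[OF P Q(1)] by simp
  then show ?thesis
    by auto
qed

lemma equiv_row_equiv: "equiv (full_rank_mats N d) (row_equiv N d)"
proof (rule equivI)
  show "row_equiv N d \<subseteq> full_rank_mats N d \<times> full_rank_mats N d"
    by (auto simp: row_equiv_def)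
  show "refl_on (full_rank_mats N d) (row_equiv N d)"
  proof (rule refl_onI)
    fix A :: "complex mat" assume A: "A \<in> full_rank_mats N d"
    then have "A = 1\<^sub>m d * A"
      by (auto simp: full_rank_mats_def)
    moreover have "invertible_mat (1\<^sub>m d :: complex mat)"
      by (auto simp: invertible_mat_iff_inverse[of _ d])
    ultimately show "(A, A) \<in> row_equiv N d"
      using A by (auto simp: row_equiv_def intro!: bexI[of _ "1\<^sub>m d"])
  qed
  show "sym (row_equiv N d)"
  proof (rule symI)
    fix A B :: "complex mat" assume "(A, B) \<in> row_equiv N d"
    then obtain P where *: "A \<in> full_rank_mats N d" "B \<in> full_rank_mats N d"
      "P \<in> carrier_mat d d" "invertible_mat P" "B = P * A"
      by (auto simp: row_equiv_def)
    then obtain Q where Q: "Q \<in> carrier_mat d d" "P * Q = 1\<^sub>m d" "Q * P = 1\<^sub>m d"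
      using invertible_mat_iff_inverse by blast
    have A: "A \<in> carrier_mat d N"
      using * by (simp add: full_rank_mats_def)
    have "Q * B = Q * P * A"
      using assoc_mult_mat[OF Q(1) *(3) A] *(5) by simp
    then have "A = Q * B"
      using Q A by simp
    moreover have "invertible_mat Q"
      using Q *(3) invertible_mat_iff_inverse[OF Q(1)] by blast
    ultimately show "(B, A) \<in> row_equiv N d"
      using * Q by (auto simp: row_equiv_def)
  qed
  show "trans (row_equiv N d)"
  proof (rule transI)
    fix A B C :: "complex mat" assume AB: "(A, B) \<in> row_equiv N d" and BC: "(B, C) \<in> row_equiv N d"
    obtain P where P: "P \<in> carrier_mat d d" "invertible_mat P" "B = P * A"
      using AB by (auto simp: row_equiv_def)
    obtain P' where P': "P' \<in> carrier_mat d d" "invertible_mat P'" "C = P' * B"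
      using BC by (auto simp: row_equiv_def)
    obtain Q where Q: "Q \<in> carrier_mat d d" "P * Q = 1\<^sub>m d" "Q * P = 1\<^sub>m d"
      using invertible_mat_iff_inverse[OF P(1)] P(2) by blast
    obtain Q' where Q': "Q' \<in> carrier_mat d d" "P' * Q' = 1\<^sub>m d" "Q' * P' = 1\<^sub>m d"
      using invertible_mat_iff_inverse[OF P'(1)] P'(2) by blast
    have A: "A \<in> carrier_mat d N"
      using AB by (simp add: row_equiv_def full_rank_mats_def)
    have PP: "P' * P \<in> carrier_mat d d" and QQ: "Q * Q' \<in> carrier_mat d d"
      using P P' Q Q' by auto
    have "(P' * P) * (Q * Q') = P' * (P * (Q * Q'))"
      by (rule assoc_mult_mat[OF P'(1) P(1) QQ])
    also have "P * (Q * Q') = (P * Q) * Q'"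
      by (rule assoc_mult_mat[OF P(1) Q(1) Q'(1), symmetric])
    finally have PPQQ: "(P' * P) * (Q * Q') = 1\<^sub>m d"
      using Q Q' by simp
    then have "invertible_mat (P' * P)"
      unfolding invertible_mat_iff_inverse[OF PP]
      using QQ mat_mult_left_right_inverse[OF PP QQ PPQQ] by blast
    moreover have "C = (P' * P) * A"
      using assoc_mult_mat[OF P'(1) P(1) A] P P' by simp
    moreover have "A \<in> full_rank_mats N d" "C \<in> full_rank_mats N d"
      using AB BC by (simp_all add: row_equiv_def)
    ultimately show "(A, C) \<in> row_equiv N d"
      using PP unfolding row_equiv_def by blast
  qed
qed

lemma Gr_carrier: "X \<in> Gr N d \<Longrightarrow> A \<in> X \<Longrightarrow> A \<in> full_rank_mats N d"
  using in_quotient_imp_subset[OF equiv_row_equiv] unfolding Gr_def by blast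

lemma Gr_representatives:
  assumes X: "X \<in> Gr N d" and "A \<in> X" "A' \<in> X"
  obtains P where "P \<in> carrier_mat d d" "det P \<noteq> 0" "A' = P * A"
proof -
  have "(A, A') \<in> row_equiv N d"
    using assms quotient_eq_iff[OF equiv_row_equiv, of X N d X A A'] by (simp add: Gr_def)
  then show thesis
    using that invertible_mat_det by (auto simp: row_equiv_def)
qed

text \<open>The representative picked by \<open>SOME\<close> in \<open>pluecker\<close> can be
  replaced by any other one, because the determinant of the transition matrix cancels in the
  ratio.\<close>

lemma pluecker_eq:
  assumes X: "X \<in> Gr (k + d) d" and A: "A \<in> X"
  shows "pluecker (k + d) k X \<mu> = maximal_minor (k + d) k A \<mu> / maximal_minor (k + d) k A empty_part"
proof -
  define A' where "A' = (SOME A. A \<in> X)"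
  have "A' \<in> X"
    unfolding A'_def using A by (rule someI)
  then obtain P where P: "P \<in> carrier_mat d d" "det P \<noteq> 0" "A' = P * A"
    using Gr_representatives[OF X A] by blast
  have "A \<in> carrier_mat d (k + d)"
    using Gr_carrier[OF X A] by (simp add: full_rank_mats_def)
  then show ?thesis
    using P maximal_minor_mult[OF P(1)] by (simp add: pluecker_def Let_def flip: A'_def)
qed

lemma Gr_maximal_minor_nonzero:
  assumes X: "X \<in> Gr (k + d) d" and "A \<in> X" "A' \<in> X" and "maximal_minor (k + d) k A \<mu> \<noteq> 0"
  shows "maximal_minor (k + d) k A' \<mu> \<noteq> 0"
proof -
  obtain P where "P \<in> carrier_mat d d" "det P \<noteq> 0" "A' = P * A"
    using Gr_representatives assms by blast
  moreover have "A \<in> carrier_mat d (k + d)"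
    using Gr_carrier[OF X \<open>A \<in> X\<close>] by (simp add: full_rank_mats_def)
  ultimately show ?thesis
    using assms maximal_minor_mult by simp
qed

section \<open>The chart p_empty = 1 and the quotients with an extra box\<close>

definition pluecker_chart :: "nat \<Rightarrow> nat \<Rightarrow> complex mat set set" where
  "pluecker_chart k d = {X \<in> Gr (k + d) d. \<forall>A\<in>X. maximal_minor (k + d) k A empty_part \<noteq> 0}"

text \<open>A single matrix provides all numerators and a single constant all denominators, so a
  quadratic relation between minors passes to the coordinates after division by the square of
  c.\<close>

lemma pluecker_chart_minor:
  assumes "X \<in> pluecker_chart k d"
  obtains F c where "c \<noteq> 0" "\<And>\<mu>. pluecker (k + d) k X \<mu> = minor F k d \<mu> / c" "minor F k d empty_part = c"
proof -
  have X: "X \<in> Gr (k + d) d"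
    using assms by (simp add: pluecker_chart_def)
  then obtain A where A: "A \<in> X"
    using in_quotient_imp_non_empty[OF equiv_row_equiv] unfolding Gr_def by blast
  then have "A \<in> carrier_mat d (k + d)"
    using Gr_carrier[OF X A] by (simp add: full_rank_mats_def)
  note mm = maximal_minor_eq[OF this]
  show thesis
    using assms A by (intro that[of "maximal_minor (k + d) k A empty_part" "\<lambda>i j. A $$ (i, j)"])
      (auto simp: pluecker_chart_def pluecker_eq mm)
qed

lemma pluecker_empty: "X \<in> pluecker_chart k d \<Longrightarrow> pluecker (k + d) k X empty_part = 1"
  using pluecker_chart_minor by (metis divide_self)

lemma pluecker_extra_col_quotient:
  assumes X: "X \<in> pluecker_chart k d"
    and nz: "\<And>a b. 1 \<le> a \<Longrightarrow> a \<le> k \<Longrightarrow> 1 \<le> b \<Longrightarrow> b \<le> d \<Longrightarrow> pluecker (k + d) k X (rect a b) \<noteq> 0"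
    and b: "1 \<le> b" "b < d" and k: "1 \<le> k"
  defines "R \<equiv> \<lambda>a b. pluecker (k + d) k X (rect a b)"
  shows "pluecker (k + d) k X (rect_extra_col k b) / R k b =
    (\<Sum>a = 1..k. R a (b + 1) * R (a - 1) (b - 1) / (R (a - 1) b * R a b))"
proof -
  obtain F c where Fc: "c \<noteq> 0" "\<And>\<mu>. pluecker (k + d) k X \<mu> = minor F k d \<mu> / c" "minor F k d empty_part = c"
    using pluecker_chart_minor[OF X] by blast
  have R0: "R 0 b = 1" "R b 0 = 1" for b
    using pluecker_empty[OF X] by (simp_all add: R_def)
  have Rnz: "R a b' \<noteq> 0" if "a \<le> k" "b' \<le> d" for a b'
    using nz[of a b'] R0 that by (cases "a = 0 \<or> b' = 0") (auto simp: R_def)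
  \<comment> \<open>The number of parts is freed from k so that it can grow from 1. There the
    partition is the rectangle 1 x (b+1), and its quotient is the first summand.\<close>
  have "a \<le> k \<Longrightarrow> pluecker (k + d) k X (rect_extra_col a b) / R a b =
    (\<Sum>a = 1..a. R a (b + 1) * R (a - 1) (b - 1) / (R (a - 1) b * R a b))" if "1 \<le> a" for a
    using that
  proof (induction a rule: dec_induct)
    case base
    have "rect_extra_col 1 b = rect 1 (b + 1)"
      by (auto simp: rect_def rect_extra_col_def)
    then show ?case
      by (simp add: R0) (simp add: R_def)
  next
    case (step a)
    have "pluecker (k + d) k X (rect_extra_col (Suc a) b) * R a b =
        pluecker (k + d) k X (rect_extra_col a b) * R (Suc a) b + R (Suc a) (b + 1) * R a (b - 1)"
      unfolding R_def Fc(2) using plucker_extra_col[of "Suc a" k b d F] step(1,4) b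
      by (simp flip: add_divide_distrib)
    then show ?case
      using step Rnz[of a b] Rnz[of "Suc a" b] b
      by (simp add: field_simps flip: step.IH)
  qed
  then show ?thesis
    using k by blast
qed

lemma pluecker_extra_row_quotient:
  assumes X: "X \<in> pluecker_chart k d"
    and nz: "\<And>a b. 1 \<le> a \<Longrightarrow> a \<le> k \<Longrightarrow> 1 \<le> b \<Longrightarrow> b \<le> d \<Longrightarrow> pluecker (k + d) k X (rect a b) \<noteq> 0"
    and a: "1 \<le> a" "a < k" and d: "1 \<le> d"
  defines "R \<equiv> \<lambda>a b. pluecker (k + d) k X (rect a b)"
  shows "pluecker (k + d) k X (rect_extra_row a d) / R a d =
    (\<Sum>b = 1..d. R (a + 1) b * R (a - 1) (b - 1) / (R a (b - 1) * R a b))"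
proof -
  obtain F c where Fc: "c \<noteq> 0" "\<And>\<mu>. pluecker (k + d) k X \<mu> = minor F k d \<mu> / c" "minor F k d empty_part = c"
    using pluecker_chart_minor[OF X] by blast
  have R0: "R 0 b = 1" "R b 0 = 1" for b
    using pluecker_empty[OF X] by (simp_all add: R_def)
  have Rnz: "R a b' \<noteq> 0" if "a \<le> k" "b' \<le> d" for a b'
    using nz[of a b'] R0 that by (cases "a = 0 \<or> b' = 0") (auto simp: R_def)
  \<comment> \<open>Here the width grows from 1, where the partition is the rectangle (a+1) x
    1.\<close>
  have "b \<le> d \<Longrightarrow> pluecker (k + d) k X (rect_extra_row a b) / R a b =
    (\<Sum>b = 1..b. R (a + 1) b * R (a - 1) (b - 1) / (R a (b - 1) * R a b))" if "1 \<le> b" for b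
    using that
  proof (induction b rule: dec_induct)
    case base
    have "rect_extra_row a 1 = rect (a + 1) 1"
      by (auto simp: rect_def rect_extra_row_def)
    then show ?case
      by (simp add: R0) (simp add: R_def)
  next
    case (step b)
    have "pluecker (k + d) k X (rect_extra_row a (Suc b)) * R a b =
        pluecker (k + d) k X (rect_extra_row a b) * R a (Suc b) + R (a + 1) (Suc b) * R (a - 1) b"
      unfolding R_def Fc(2) using plucker_extra_row[of a k "Suc b" d F] step(1,4) a
      by (simp flip: add_divide_distrib)
    then show ?case
      using step Rnz[of a b] Rnz[of a "Suc b"] a
      by (simp add: field_simps flip: step.IH)
  qed
  then show ?thesis
    using d by blast
qed

section \<open>The rectangles chart of one factor\<close>

definition normal_form :: "nat \<Rightarrow> (nat \<Rightarrow> nat \<Rightarrow> complex) \<Rightarrow> nat \<Rightarrow> nat \<Rightarrow> complex" where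
  "normal_form k B i j = (if j < k then B i j else if j = k + i then 1 else 0)"

text \<open>The window of b columns starting at k - a has b rows in all cases; for b > a it runs
  past B into the identity block.\<close>

definition rect_minor :: "nat \<Rightarrow> (nat \<Rightarrow> nat \<Rightarrow> complex) \<Rightarrow> nat \<Rightarrow> nat \<Rightarrow> complex" where
  "rect_minor k B a b = det (mat b b (\<lambda>(i, j). normal_form k B i (k - a + j)))"

text \<open>Beyond the first b columns the minor of a x b uses the unit vectors of the rows b, ...,
  d-1. The matrix is block triangular with an identity block, which leaves the window.\<close>

lemma minor_normal_form:
  assumes "a \<le> k" "b \<le> d"
  shows "minor (normal_form k B) k d (rect a b) = rect_minor k B a b"
proof -
  let ?U = "mat b b (\<lambda>(i, j). normal_form k B i (k - a + j))"
  let ?V = "mat (d - b) b (\<lambda>(i, j). normal_form k B (b + i) (k - a + j))"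
  have "mat d d (\<lambda>(i, j). normal_form k B i (map (hpos k (rect a b)) [0..<d] ! j)) =
      four_block_mat ?U (0\<^sub>m b (d - b)) ?V (1\<^sub>m (d - b))"
  proof (rule eq_matI)
    fix i j assume "i < dim_row (four_block_mat ?U (0\<^sub>m b (d - b)) ?V (1\<^sub>m (d - b)))"
      "j < dim_col (four_block_mat ?U (0\<^sub>m b (d - b)) ?V (1\<^sub>m (d - b)))"
    then have "i < d" "j < d"
      using assms by simp_all
    then show "mat d d (\<lambda>(i, j). normal_form k B i (map (hpos k (rect a b)) [0..<d] ! j)) $$ (i, j) =
        four_block_mat ?U (0\<^sub>m b (d - b)) ?V (1\<^sub>m (d - b)) $$ (i, j)"
      using assms by (cases "j < b"; cases "i < b") (auto simp: hpos_rect add.commute normal_form_def)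
  qed (use assms in auto)
  moreover have "det (four_block_mat ?U (0\<^sub>m b (d - b)) ?V (1\<^sub>m (d - b))) = det ?U * det (1\<^sub>m (d - b))"
    by (rule det_four_block_mat_upper_right_zero[of _ b _ "d - b"]) auto
  ultimately show ?thesis
    by (simp add: cdet_def rect_minor_def)
qed

lemma rect_minor_0 [simp]: "rect_minor k B a 0 = 1"
  by (simp add: rect_minor_def det_dim_zero)

lemma rect_minor_0' [simp]: "rect_minor k B 0 b = 1"
proof -
  have "mat b b (\<lambda>(i, j). normal_form k B i (k - 0 + j)) = 1\<^sub>m b"
    by (rule eq_matI) (auto simp: normal_form_def)
  then show ?thesis
    unfolding rect_minor_def by simp
qed

text \<open>The entry of B in row b-1 and column k-a is labelled by (a, b), the rectangle whose
  window has it as lower left corner. The window of a x b meets B only in entries with labels inside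
  a x b.\<close>

lemma rect_minor_cong:
  assumes "\<And>a' b'. \<lbrakk>1 \<le> a'; a' \<le> a; 1 \<le> b'; b' \<le> b\<rbrakk> \<Longrightarrow> B (b' - 1) (k - a') = B' (b' - 1) (k - a')"
  shows "rect_minor k B a b = rect_minor k B' a b"
proof -
  have "normal_form k B i (k - a + j) = normal_form k B' i (k - a + j)" if "i < b" "j < b" for i j
  proof (cases "k - a + j < k")
    case True
    then show ?thesis
      using assms[of "k - (k - a + j)" "Suc i"] that by (simp add: normal_form_def)
  qed (simp add: normal_form_def)
  then show ?thesis
    unfolding rect_minor_def by (auto intro!: arg_cong[of _ _ det] eq_matI)
qed

text \<open>Laplace expansion along the first column: the rectangular minors are linear in their
  lower left entry, with coefficient the minor of the rectangle with one row and column less.\<close>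

lemma rect_minor_corner:
  assumes a: "1 \<le> a" "a \<le> k" and b: "1 \<le> b"
    and eq: "\<And>a' b'. \<lbrakk>1 \<le> a'; a' \<le> a; 1 \<le> b'; b' \<le> b; a' + b' < a + b\<rbrakk> \<Longrightarrow>
      B (b' - 1) (k - a') = B' (b' - 1) (k - a')"
  shows "rect_minor k B a b - rect_minor k B' a b =
    (-1) ^ (b - 1) * (B (b - 1) (k - a) - B' (b - 1) (k - a)) * rect_minor k B (a - 1) (b - 1)"
proof -
  define M where "M B = mat b b (\<lambda>(i, j). normal_form k B i (k - a + j))" for B
  have expand: "rect_minor k B a b =
      (\<Sum>i<b - 1. B i (k - a) * cofactor (M B) i 0) + B (b - 1) (k - a) * cofactor (M B) (b - 1) 0" for B
  proof -
    have "rect_minor k B a b = (\<Sum>i<b. M B $$ (i, 0) * cofactor (M B) i 0)"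
      unfolding rect_minor_def using b by (subst laplace_expansion_column[of _ b 0]) (auto simp: M_def)
    also have "\<dots> = (\<Sum>i<b. B i (k - a) * cofactor (M B) i 0)"
      using a b by (intro sum.cong) (auto simp: M_def normal_form_def)
    finally show ?thesis
      using b by (cases b) auto
  qed
  \<comment> \<open>These cofactors omit column k - a, so they see only labels (a', b') with a' < a
    and b' \<le> b, where a' + b' < a + b.\<close>
  have cof: "cofactor (M B) i 0 = cofactor (M B') i 0" if "i < b" for i
  proof -
    have "normal_form k B i' (k - a + Suc j) = normal_form k B' i' (k - a + Suc j)"
      if "i' < b" "Suc j < b" for i' j
    proof (cases "k - a + Suc j < k")
      case True
      then have "1 \<le> a - Suc j" and j: "k - (a - Suc j) = k - a + Suc j"
        using a by linarith+
      moreover have "a - Suc j + Suc i' < a + b"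
        using that a by linarith
      ultimately have "B (Suc i' - 1) (k - (a - Suc j)) = B' (Suc i' - 1) (k - (a - Suc j))"
        using that by (intro eq) auto
      then show ?thesis
        using True j by (simp add: normal_form_def)
    qed (simp add: normal_form_def)
    then have "mat_delete (M B) i 0 = mat_delete (M B') i 0"
      using that by (intro eq_matI) (auto simp: mat_delete_def M_def)
    then show ?thesis
      by (simp add: cofactor_def)
  qed
  have "mat_delete (M B) (b - 1) 0 = mat (b - 1) (b - 1) (\<lambda>(i, j). normal_form k B i (k - (a - 1) + j))"
    using a by (intro eq_matI) (auto simp: mat_delete_def M_def Suc_diff_le)
  then have corner: "cofactor (M B) (b - 1) 0 = (-1) ^ (b - 1) * rect_minor k B (a - 1) (b - 1)"
    by (simp add: cofactor_def rect_minor_def)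
  \<comment> \<open>The entries above the corner have labels (a, i+1) with i+1 < b, so B and B'
    agree there too.\<close>
  have "(\<Sum>i<b - 1. B i (k - a) * cofactor (M B) i 0) = (\<Sum>i<b - 1. B' i (k - a) * cofactor (M B') i 0)"
  proof (intro sum.cong refl)
    fix i assume "i \<in> {..<b - 1}"
    then show "B i (k - a) * cofactor (M B) i 0 = B' i (k - a) * cofactor (M B') i 0"
      using cof[of i] eq[of a "Suc i"] a by simp
  qed
  then show ?thesis
    unfolding expand[of B] expand[of B'] using cof[of "b - 1"] b corner by (simp add: algebra_simps)
qed

text \<open>Once B and B' agree at all labels of smaller sum, equality of the minors says that the
  difference of the corner entries times a smaller minor vanishes. That minor is 1 or one of the
  nonzero coordinates.\<close>

lemma rect_minor_inj:
  assumes nz: "\<And>a b. \<lbrakk>1 \<le> a; a \<le> k; 1 \<le> b; b \<le> d\<rbrakk> \<Longrightarrow> rect_minor k B a b \<noteq> 0"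
    and eq: "\<And>a b. \<lbrakk>1 \<le> a; a \<le> k; 1 \<le> b; b \<le> d\<rbrakk> \<Longrightarrow> rect_minor k B a b = rect_minor k B' a b"
    and "1 \<le> a" "a \<le> k" "1 \<le> b" "b \<le> d"
  shows "B (b - 1) (k - a) = B' (b - 1) (k - a)"
  using assms(3-)
proof (induction "a + b" arbitrary: a b rule: less_induct)
  case less
  have "(-1) ^ (b - 1) * (B (b - 1) (k - a) - B' (b - 1) (k - a)) * rect_minor k B (a - 1) (b - 1) =
      rect_minor k B a b - rect_minor k B' a b"
    using less by (intro rect_minor_corner[symmetric]) auto
  also have "\<dots> = 0"
    using eq less.prems by simp
  finally have *: "(-1) ^ (b - 1) * (B (b - 1) (k - a) - B' (b - 1) (k - a)) * rect_minor k B (a - 1) (b - 1) = 0" .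
  have "rect_minor k B (a - 1) (b - 1) \<noteq> 0"
  proof (cases "a = 1 \<or> b = 1")
    case False
    then have "1 \<le> a - 1" "1 \<le> b - 1" using less.prems by linarith+
    then show ?thesis using nz less.prems by simp
  qed auto
  then show ?case
    using * by simp
qed

text \<open>B is corrected on one antidiagonal a + b = s + 1 at a time. Windows with a + b \<le> s
  do not see the change, and a window on the antidiagonal sees it only in its own corner, so all
  corrections of one round are independent.\<close>

lemma rect_minor_surj:
  fixes x :: "nat \<Rightarrow> nat \<Rightarrow> complex"
  assumes nz: "\<And>a b. \<lbrakk>1 \<le> a; a \<le> k; 1 \<le> b; b \<le> d\<rbrakk> \<Longrightarrow> x a b \<noteq> 0"
  obtains B where "\<And>a b. \<lbrakk>1 \<le> a; a \<le> k; 1 \<le> b; b \<le> d\<rbrakk> \<Longrightarrow> rect_minor k B a b = x a b"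
proof -
  have "\<exists>B. \<forall>a b. 1 \<le> a \<and> a \<le> k \<and> 1 \<le> b \<and> b \<le> d \<and> a + b \<le> s \<longrightarrow> rect_minor k B a b = x a b" for s
  proof (induction s)
    case 0
    then show ?case by auto
  next
    case (Suc s)
    then obtain B where B: "\<And>a b. \<lbrakk>1 \<le> a; a \<le> k; 1 \<le> b; b \<le> d; a + b \<le> s\<rbrakk> \<Longrightarrow> rect_minor k B a b = x a b"
      by blast
    \<comment> \<open>The solution of the linear equation for the corner entry; the sign is its own
      inverse.\<close>
    define corr where "corr a b = (-1) ^ (b - 1) * (x a b - rect_minor k B a b) / rect_minor k B (a - 1) (b - 1)" for a b
    \<comment> \<open>The entry (i, j) has the label (k - j, Suc i), so the condition singles out
      the antidiagonal.\<close>
    define B' where "B' i j = B i j + (if Suc i + (k - j) = Suc s then corr (k - j) (Suc i) else 0)" for i j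
    have B'_eq: "B' (b - 1) (k - a) = B (b - 1) (k - a)" if "1 \<le> a" "a \<le> k" "1 \<le> b" "a + b \<le> s" for a b
      using that by (simp add: B'_def)
    have same: "rect_minor k B' a b = rect_minor k B a b" if "a \<le> k" "a + b \<le> s" for a b
      using that B'_eq by (intro rect_minor_cong) auto
    have "rect_minor k B' a b = x a b" if ab: "1 \<le> a" "a \<le> k" "1 \<le> b" "b \<le> d" "a + b \<le> Suc s" for a b
    proof (cases "a + b \<le> s")
      case True
      then show ?thesis using same B that by simp
    next
      case False
      then have s: "a + b = Suc s" using ab by simp
      have nz': "rect_minor k B (a - 1) (b - 1) \<noteq> 0"
      proof (cases "a = 1 \<or> b = 1")
        case False
        then have "1 \<le> a - 1" "1 \<le> b - 1" using ab by linarith+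
        then show ?thesis using B[of "a - 1" "b - 1"] nz[of "a - 1" "b - 1"] ab s by simp
      qed auto
      have "rect_minor k B' a b - rect_minor k B a b =
          (-1) ^ (b - 1) * (B' (b - 1) (k - a) - B (b - 1) (k - a)) * rect_minor k B' (a - 1) (b - 1)"
        using ab s B'_eq by (intro rect_minor_corner) auto
      also have "rect_minor k B' (a - 1) (b - 1) = rect_minor k B (a - 1) (b - 1)"
        using ab s by (intro same) auto
      also have "B' (b - 1) (k - a) - B (b - 1) (k - a) = corr a b"
        using ab s by (simp add: B'_def)
      also have "(-1) ^ (b - 1) * corr a b * rect_minor k B (a - 1) (b - 1) = x a b - rect_minor k B a b"
        using nz' by (simp add: corr_def flip: power_add mult.assoc)
      finally show ?thesis by simp
    qed
    then show ?case by blast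
  qed
  from this[of "k + d"] show thesis
    using that by (meson add_mono)
qed

section \<open>Matrices [B | I] as representatives of the points of the chart\<close>

definition normal_mat :: "nat \<Rightarrow> nat \<Rightarrow> (nat \<Rightarrow> nat \<Rightarrow> complex) \<Rightarrow> complex mat" where
  "normal_mat k d B = mat d (k + d) (\<lambda>(i, j). normal_form k B i j)"

lemma normal_mat_carrier [simp]: "normal_mat k d B \<in> carrier_mat d (k + d)"
  by (simp add: normal_mat_def)

lemma minor_cong:
  assumes "\<And>i j. i < d \<Longrightarrow> j < k + d \<Longrightarrow> F i j = F' i j"
  shows "minor F k d \<mu> = minor F' k d \<mu>"
  unfolding cdet_def using assms hpos_less by (auto intro!: arg_cong[of _ _ det] eq_matI)

lemma maximal_minor_normal_mat:
  assumes "a \<le> k" "b \<le> d"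
  shows "maximal_minor (k + d) k (normal_mat k d B) (rect a b) = rect_minor k B a b"
  unfolding maximal_minor_eq[OF normal_mat_carrier] minor_normal_form[OF assms, symmetric]
  by (rule minor_cong) (simp add: normal_mat_def)

lemma maximal_minor_normal_mat_empty [simp]:
  "maximal_minor (k + d) k (normal_mat k d B) empty_part = 1"
  using maximal_minor_normal_mat[of 0 k 0 d B] by simp

text \<open>The empty partition selects the last d columns. Their square matrix L is invertible by
  the chart condition, and multiplying by its inverse turns them into the identity.\<close>

lemma normal_mat_in_class:
  assumes X: "X \<in> pluecker_chart k d"
  obtains B where "normal_mat k d B \<in> X"
proof -
  have G: "X \<in> Gr (k + d) d"
    using X by (simp add: pluecker_chart_def)
  then obtain A where A: "A \<in> X"
    using in_quotient_imp_non_empty[OF equiv_row_equiv] unfolding Gr_def by blast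
  have full: "A \<in> full_rank_mats (k + d) d"
    using Gr_carrier[OF G A] .
  then have carr: "A \<in> carrier_mat d (k + d)"
    by (simp add: full_rank_mats_def)
  define L where "L = mat d d (\<lambda>(i, j). A $$ (i, k + j))"
  have "hpos k empty_part j = k + j" for j
    using hpos_rect[of 0 k 0 j] by simp
  then have "maximal_minor (k + d) k A empty_part = det L"
    by (simp add: maximal_minor_def submatrix_horizontal_steps[OF carr] L_def)
  then have "det L \<noteq> 0"
    using X A by (auto simp: pluecker_chart_def)
  then obtain P where P: "P \<in> carrier_mat d d" "P * L = 1\<^sub>m d" "L * P = 1\<^sub>m d"
    using inverse_mat_exists[of L d] by (auto simp: L_def)
  have PA: "P * A = normal_mat k d (\<lambda>i j. (P * A) $$ (i, j))"
  proof (rule eq_matI)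
    fix i j assume *: "i < dim_row (normal_mat k d (\<lambda>i j. (P * A) $$ (i, j)))"
      "j < dim_col (normal_mat k d (\<lambda>i j. (P * A) $$ (i, j)))"
    show "(P * A) $$ (i, j) = normal_mat k d (\<lambda>i j. (P * A) $$ (i, j)) $$ (i, j)"
    proof (cases "j < k")
      case False
      have "(P * A) $$ (i, j) = (P * L) $$ (i, j - k)"
        using * P(1) carr False by (simp add: L_def scalar_prod_def normal_mat_def)
      then show ?thesis
        using * False by (auto simp: P(2) normal_mat_def normal_form_def)
    qed (use * in \<open>simp add: normal_mat_def normal_form_def\<close>)
  qed (use P carr in \<open>auto simp: normal_mat_def\<close>)
  have "P * A \<in> full_rank_mats (k + d) d"
    by (subst PA, rule full_rank_mats_minorI[of _ _ _ empty_part]) auto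
  moreover have "invertible_mat P"
    using P L_def invertible_mat_iff_inverse[OF P(1)] by auto
  ultimately have "(A, P * A) \<in> row_equiv (k + d) d"
    using full P(1) unfolding row_equiv_def by blast
  then have "P * A \<in> X"
    using G A in_quotient_imp_closed[OF equiv_row_equiv] unfolding Gr_def by blast
  then show thesis
    using that PA by metis
qed

lemma pluecker_normal_mat:
  assumes "X \<in> pluecker_chart k d" "normal_mat k d B \<in> X" "a \<le> k" "b \<le> d"
  shows "pluecker (k + d) k X (rect a b) = rect_minor k B a b"
  using assms by (subst pluecker_eq[of X k d "normal_mat k d B"])
    (auto simp: pluecker_chart_def maximal_minor_normal_mat)

text \<open>Equal coordinates force equal entries of B, hence a common representative, and
  equivalence classes that meet coincide.\<close>

lemma pluecker_chart_inj:
  assumes X: "X \<in> pluecker_chart k d" and X': "X' \<in> pluecker_chart k d"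
    and nz: "\<And>a b. \<lbrakk>1 \<le> a; a \<le> k; 1 \<le> b; b \<le> d\<rbrakk> \<Longrightarrow> pluecker (k + d) k X (rect a b) \<noteq> 0"
    and eq: "\<And>a b. \<lbrakk>1 \<le> a; a \<le> k; 1 \<le> b; b \<le> d\<rbrakk> \<Longrightarrow>
      pluecker (k + d) k X (rect a b) = pluecker (k + d) k X' (rect a b)"
  shows "X = X'"
proof -
  obtain B B' where B: "normal_mat k d B \<in> X" and B': "normal_mat k d B' \<in> X'"
    using normal_mat_in_class X X' by metis
  have "B (b - 1) (k - a) = B' (b - 1) (k - a)" if "1 \<le> a" "a \<le> k" "1 \<le> b" "b \<le> d" for a b
    using that nz eq by (intro rect_minor_inj[of k d B B'])
      (auto simp flip: pluecker_normal_mat[OF X B] pluecker_normal_mat[OF X' B'])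
  from this[of "k - j" "Suc i" for i j] have "normal_mat k d B = normal_mat k d B'"
    by (intro eq_matI) (auto simp: normal_mat_def normal_form_def)
  then have "normal_mat k d B \<in> X \<inter> X'"
    using B B' by simp
  then show ?thesis
    using X X' quotient_disj[OF equiv_row_equiv] unfolding pluecker_chart_def Gr_def by blast
qed

lemma pluecker_chart_surj:
  fixes x :: "nat \<Rightarrow> nat \<Rightarrow> complex"
  assumes nz: "\<And>a b. \<lbrakk>1 \<le> a; a \<le> k; 1 \<le> b; b \<le> d\<rbrakk> \<Longrightarrow> x a b \<noteq> 0"
  obtains X where "X \<in> pluecker_chart k d"
    "\<And>a b. \<lbrakk>1 \<le> a; a \<le> k; 1 \<le> b; b \<le> d\<rbrakk> \<Longrightarrow> pluecker (k + d) k X (rect a b) = x a b"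
proof -
  obtain B where B: "\<And>a b. \<lbrakk>1 \<le> a; a \<le> k; 1 \<le> b; b \<le> d\<rbrakk> \<Longrightarrow> rect_minor k B a b = x a b"
    using rect_minor_surj[of k d x] nz by blast
  define X where "X = row_equiv (k + d) d `` {normal_mat k d B}"
  have full: "normal_mat k d B \<in> full_rank_mats (k + d) d"
    by (rule full_rank_mats_minorI[of _ _ _ empty_part]) auto
  then have G: "X \<in> Gr (k + d) d"
    unfolding X_def Gr_def by (rule quotientI)
  have in_X: "normal_mat k d B \<in> X"
    unfolding X_def using full by (rule equiv_class_self[OF equiv_row_equiv])
  have "X \<in> pluecker_chart k d"
    using G Gr_maximal_minor_nonzero[OF G in_X, of _ empty_part] by (simp add: pluecker_chart_def)
  then show thesis
    using that[of X] pluecker_normal_mat[OF _ in_X] B by simp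
qed

section \<open>Laurent monomials and the change of variables\<close>

text \<open>A class closed under products and quotients. It spares the explicit exponent sets in
  \<open>laurent_on_torus\<close> and \<open>laurent_over_int_q\<close>, since every term that
  occurs is a scalar or a single q_i times such a monomial.\<close>

definition laurent_monomial :: "'k set \<Rightarrow> (('k \<Rightarrow> complex) \<Rightarrow> complex) \<Rightarrow> bool" where
  "laurent_monomial I f \<longleftrightarrow> (\<exists>e :: 'k \<Rightarrow> int. \<forall>x\<in>torus I. f x = (\<Prod>k\<in>I. x k powi e k))"

lemma torus_nonzero: "x \<in> torus I \<Longrightarrow> k \<in> I \<Longrightarrow> x k \<noteq> 0"
  by (auto simp: torus_def)

lemma laurent_monomial_one [intro]: "laurent_monomial I (\<lambda>x. 1)"
  unfolding laurent_monomial_def by (rule exI[of _ "\<lambda>_. 0"]) simp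

lemma laurent_monomial_coordinate [intro]:
  assumes "finite I" "k \<in> I"
  shows "laurent_monomial I (\<lambda>x. x k)"
proof -
  have "(\<Prod>k'\<in>I. x k' powi (if k' = k then 1 else 0)) = x k" for x :: "'a \<Rightarrow> complex"
    using assms by (simp add: if_distrib[of "\<lambda>e. _ powi e"] prod.delta cong: if_cong)
  then show ?thesis
    unfolding laurent_monomial_def by (intro exI[of _ "\<lambda>k'. if k' = k then 1 else 0"]) simp
qed

lemma laurent_monomial_mult [intro]:
  assumes "laurent_monomial I f" "laurent_monomial I g"
  shows "laurent_monomial I (\<lambda>x. f x * g x)"
proof -
  obtain e e' where "\<forall>x\<in>torus I. f x = (\<Prod>k\<in>I. x k powi e k)" "\<forall>x\<in>torus I. g x = (\<Prod>k\<in>I. x k powi e' k)"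
    using assms unfolding laurent_monomial_def by blast
  then show ?thesis
    unfolding laurent_monomial_def
    by (intro exI[of _ "\<lambda>k. e k + e' k"]) (simp add: power_int_add torus_nonzero prod.distrib)
qed

lemma laurent_monomial_divide [intro]:
  assumes "laurent_monomial I f" "laurent_monomial I g"
  shows "laurent_monomial I (\<lambda>x. f x / g x)"
proof -
  obtain e e' where "\<forall>x\<in>torus I. f x = (\<Prod>k\<in>I. x k powi e k)" "\<forall>x\<in>torus I. g x = (\<Prod>k\<in>I. x k powi e' k)"
    using assms unfolding laurent_monomial_def by blast
  then show ?thesis
    unfolding laurent_monomial_def
    by (intro exI[of _ "\<lambda>k. e k - e' k"]) (simp add: power_int_diff torus_nonzero prod_dividef)
qed

lemma laurent_monomial_prod [intro]:
  assumes "\<And>j. j \<in> J \<Longrightarrow> laurent_monomial I (f j)"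
  shows "laurent_monomial I (\<lambda>x. \<Prod>j\<in>J. f j x)"
  using assms by (induction J rule: infinite_finite_induct) auto

lemma laurent_on_torus_monomial:
  assumes "laurent_monomial I g" and "\<And>x. x \<in> torus I \<Longrightarrow> f x = c * g x"
  shows "laurent_on_torus I f"
proof -
  obtain e where e: "\<forall>x\<in>torus I. g x = (\<Prod>k\<in>I. x k powi e k)"
    using assms unfolding laurent_monomial_def by blast
  then show ?thesis
    unfolding laurent_on_torus_def using assms(2)
    by (intro exI[of _ "{e}"] exI[of _ "\<lambda>_. c"]) simp
qed

section \<open>Laurent polynomials with integral coefficients in q\<close>

lemma laurent_over_int_q_cong:
  assumes "laurent_over_int_q \<rho> I W" "\<And>q x. x \<in> torus I \<Longrightarrow> W' q x = W q x"
  shows "laurent_over_int_q \<rho> I W'"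
  using assms unfolding laurent_over_int_q_def by simp

lemma laurent_over_int_q_monomial:
  assumes "laurent_monomial I g"
  shows "laurent_over_int_q \<rho> I (\<lambda>q. g)"
proof -
  obtain e where e: "\<forall>x\<in>torus I. g x = (\<Prod>k\<in>I. x k powi e k)"
    using assms unfolding laurent_monomial_def by blast
  then show ?thesis
    unfolding laurent_over_int_q_def
    by (intro exI[of _ "{(\<lambda>_. 0, e)}"] exI[of _ "\<lambda>_. 1"]) simp
qed

lemma laurent_over_int_q_monomial':
  assumes "laurent_monomial I g" and i: "i \<in> {1..\<rho>}"
  shows "laurent_over_int_q \<rho> I (\<lambda>q x. q i * g x)"
proof -
  obtain e where e: "\<forall>x\<in>torus I. g x = (\<Prod>k\<in>I. x k powi e k)"
    using assms unfolding laurent_monomial_def by blast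
  have "(\<Prod>j = 1..\<rho>. q j ^ (if j = i then 1 else 0)) = q i" for q :: "nat \<Rightarrow> complex"
    using i by (simp add: if_distrib[of "\<lambda>e. _ ^ e"] prod.delta cong: if_cong)
  then show ?thesis
    unfolding laurent_over_int_q_def
    by (intro exI[of _ "{(\<lambda>j. if j = i then 1 else 0, e)}"] exI[of _ "\<lambda>_. 1"]) (simp add: e)
qed

lemma laurent_over_int_q_zero: "laurent_over_int_q \<rho> I (\<lambda>q x. 0)"
  unfolding laurent_over_int_q_def by (intro exI[of _ "{}"]) simp

lemma laurent_over_int_q_add:
  assumes "laurent_over_int_q \<rho> I V" "laurent_over_int_q \<rho> I W"
  shows "laurent_over_int_q \<rho> I (\<lambda>q x. V q x + W q x)"
proof -
  define t where "t q x = (\<lambda>(d, e). (\<Prod>j = 1..\<rho>. q j ^ d j) * (\<Prod>k\<in>I. x k powi e k))"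
    for q :: "nat \<Rightarrow> complex" and x :: "'a \<Rightarrow> complex" and d e
  have iff: "laurent_over_int_q \<rho> I W \<longleftrightarrow>
      (\<exists>E (c :: _ \<Rightarrow> int). finite E \<and> (\<forall>q. \<forall>x\<in>torus I. W q x = (\<Sum>\<epsilon>\<in>E. of_int (c \<epsilon>) * t q x \<epsilon>)))" for W
    unfolding laurent_over_int_q_def t_def by (simp add: case_prod_beta' mult.assoc)
  obtain E c where E: "finite E" "\<And>q x. x \<in> torus I \<Longrightarrow> V q x = (\<Sum>\<epsilon>\<in>E. of_int (c \<epsilon>) * t q x \<epsilon>)"
    using assms(1) unfolding iff by blast
  obtain E' c' where E': "finite E'" "\<And>q x. x \<in> torus I \<Longrightarrow> W q x = (\<Sum>\<epsilon>\<in>E'. of_int (c' \<epsilon>) * t q x \<epsilon>)"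
    using assms(2) unfolding iff by blast
  \<comment> \<open>The supports may overlap, so both coefficient functions are extended by zero
    before they are added.\<close>
  define c'' where "c'' \<epsilon> = (if \<epsilon> \<in> E then c \<epsilon> else 0) + (if \<epsilon> \<in> E' then c' \<epsilon> else 0)" for \<epsilon>
  have "V q x + W q x = (\<Sum>\<epsilon>\<in>E \<union> E'. of_int (c'' \<epsilon>) * t q x \<epsilon>)" if "x \<in> torus I" for q x
  proof -
    have "V q x = (\<Sum>\<epsilon>\<in>E \<union> E'. of_int (if \<epsilon> \<in> E then c \<epsilon> else 0) * t q x \<epsilon>)"
      unfolding E(2)[OF that] using E(1) E'(1) by (intro sum.mono_neutral_cong_left) auto
    moreover have "W q x = (\<Sum>\<epsilon>\<in>E \<union> E'. of_int (if \<epsilon> \<in> E' then c' \<epsilon> else 0) * t q x \<epsilon>)"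
      unfolding E'(2)[OF that] using E(1) E'(1) by (intro sum.mono_neutral_cong_left) auto
    ultimately show ?thesis
      by (simp add: c''_def distrib_right sum.distrib)
  qed
  then show ?thesis
    unfolding iff using E(1) E'(1) by (intro exI[of _ "E \<union> E'"] exI[of _ c'']) simp
qed

lemma laurent_over_int_q_sum:
  assumes "\<And>j. j \<in> J \<Longrightarrow> laurent_over_int_q \<rho> I (W j)"
  shows "laurent_over_int_q \<rho> I (\<lambda>q x. \<Sum>j\<in>J. W j q x)"
  using assms
  by (induction J rule: infinite_finite_induct)
    (auto intro: laurent_over_int_q_zero laurent_over_int_q_add)

section \<open>The change of variables and its inverse\<close>

lemma finite_indices: "finite (indices \<rho> r)"
proof -
  have "indices \<rho> r \<subseteq> (SIGMA i:{1..\<rho>}. {1..r i} \<times> {1..m r i})"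
    by (auto simp: indices_def)
  then show ?thesis
    by (rule finite_subset) auto
qed

lemma indices_diagonal:
  "(i, a, b) \<in> indices \<rho> r \<Longrightarrow> j < a \<Longrightarrow> j < b \<Longrightarrow> (i, a - j, b - j) \<in> indices \<rho> r"
  unfolding indices_def by auto

lemma phi_q_nonzero:
  assumes "\<forall>i\<in>{1..\<rho>}. q i \<noteq> 0" "i \<le> \<rho>"
  shows "phi_q q i \<noteq> 0"
  using assms by (auto simp: phi_q_def)

lemma phi_q_nonzero_index:
  assumes "\<forall>i\<in>{1..\<rho>}. q i \<noteq> 0" "(i, a, b) \<in> indices \<rho> r"
  shows "phi_q q (i - 1) \<noteq> 0"
  using assms by (intro phi_q_nonzero) (auto simp: indices_def)

text \<open>The coordinates extended by p_empty = 1 to rectangles with an empty side. This absorbs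
  the case distinction in \<open>phi_z\<close>, and at block \<rho> + 1 the convention for the empty
  partition.\<close>

definition rect_value :: "(nat \<times> nat \<times> nat \<Rightarrow> complex) \<Rightarrow> nat \<Rightarrow> nat \<Rightarrow> nat \<Rightarrow> complex" where
  "rect_value x i a b = (if a = 0 \<or> b = 0 then 1 else x (i, a, b))"

lemma rect_value_simps [simp]:
  "rect_value x i 0 b = 1" "rect_value x i a 0 = 1"
  by (simp_all add: rect_value_def)

lemma rect_value_nonzero:
  assumes "x \<in> torus (indices \<rho> r)" "i \<in> {1..\<rho>}" "a \<le> r i" "b \<le> m r i"
  shows "rect_value x i a b \<noteq> 0"
  using assms torus_nonzero[OF assms(1), of "(i, a, b)"] by (auto simp: rect_value_def indices_def)

lemma laurent_monomial_rect_value [intro]: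
  assumes "i \<in> {1..\<rho>}" "a \<le> r i" "b \<le> m r i"
  shows "laurent_monomial (indices \<rho> r) (\<lambda>x. rect_value x i a b)"
  using assms laurent_monomial_coordinate[OF finite_indices, of "(i, a, b)" \<rho> r]
  by (cases "a = 0 \<or> b = 0") (auto simp: rect_value_def indices_def)

lemma phi_z_eq:
  assumes "(i, a, b) \<in> indices \<rho> r"
  shows "phi_z \<rho> r q x (i, a, b) = phi_q q (i - 1) * rect_value x i a b / rect_value x i (a - 1) (b - 1)"
  using assms by (auto simp: phi_z_def phi_q_def rect_value_def indices_def)

text \<open>The product runs down the diagonal through \<open>(a, b)\<close>, along which \<open>phi_z\<close> telescopes.\<close>

definition phi_inv :: "nat \<Rightarrow> (nat \<Rightarrow> nat) \<Rightarrow> (nat \<Rightarrow> complex)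
    \<Rightarrow> (nat \<times> nat \<times> nat \<Rightarrow> complex) \<Rightarrow> (nat \<times> nat \<times> nat \<Rightarrow> complex)" where
  "phi_inv \<rho> r q z = (\<lambda>(i, a, b)\<in>indices \<rho> r. \<Prod>j<min a b. z (i, a - j, b - j) / phi_q q (i - 1))"

lemma phi_inv_phi:
  assumes q: "\<forall>i\<in>{1..\<rho>}. q i \<noteq> 0" and x: "x \<in> torus (indices \<rho> r)"
  shows "phi_inv \<rho> r q (phi_z \<rho> r q x) = x"
proof (rule ext, clarify)
  fix i a b
  show "phi_inv \<rho> r q (phi_z \<rho> r q x) (i, a, b) = x (i, a, b)"
  proof (cases "(i, a, b) \<in> indices \<rho> r")
    case True
    then have i: "i \<in> {1..\<rho>}" and ab: "1 \<le> a" "a \<le> r i" "1 \<le> b" "b \<le> m r i"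
      by (auto simp: indices_def)
    have Q: "phi_q q (i - 1) \<noteq> 0"
      using i by (intro phi_q_nonzero[OF q]) auto
    \<comment> \<open>All b are treated at once, because removing the factor j = 0 moves diagonally
      to (a-1, b-1).\<close>
    have "(\<Prod>j<min a b. phi_z \<rho> r q x (i, a - j, b - j) / phi_q q (i - 1)) = rect_value x i a b"
      if "a \<le> r i" "b \<le> m r i" for a b
      using that
    proof (induction a arbitrary: b)
      case (Suc a)
      show ?case
      proof (cases b)
        case b: (Suc b')
        have "(i, Suc a, Suc b') \<in> indices \<rho> r"
          using Suc.prems i b by (auto simp: indices_def)
        then have "phi_z \<rho> r q x (i, Suc a, Suc b') / phi_q q (i - 1) * rect_value x i a b' =
            rect_value x i (Suc a) (Suc b')"
          using rect_value_nonzero[OF x i, of a b'] Suc.prems b Q by (simp add: phi_z_eq)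
        then show ?thesis
          using Suc.IH[of b'] Suc.prems by (simp add: b prod.lessThan_Suc_shift del: prod.lessThan_Suc)
      qed simp
    qed simp
    then show ?thesis
      using True ab by (simp add: phi_inv_def rect_value_def)
  next
    case False
    then have "x (i, a, b) = undefined"
      using x by (auto simp: torus_def PiE_def extensional_def)
    then show ?thesis
      using False by (simp add: phi_inv_def)
  qed
qed

lemma phi_z_phi_inv:
  assumes q: "\<forall>i\<in>{1..\<rho>}. q i \<noteq> 0" and z: "z \<in> torus (indices \<rho> r)"
  shows "phi_z \<rho> r q (phi_inv \<rho> r q z) = z"
proof (rule ext, clarify)
  fix i a b
  show "phi_z \<rho> r q (phi_inv \<rho> r q z) (i, a, b) = z (i, a, b)"
  proof (cases "(i, a, b) \<in> indices \<rho> r")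
    case True
    then have i: "i \<in> {1..\<rho>}" and ab: "1 \<le> a" "a \<le> r i" "1 \<le> b" "b \<le> m r i"
      by (auto simp: indices_def)
    have Q: "phi_q q (i - 1) \<noteq> 0"
      using i by (intro phi_q_nonzero[OF q]) auto
    have val: "rect_value (phi_inv \<rho> r q z) i a b = (\<Prod>j<min a b. z (i, a - j, b - j) / phi_q q (i - 1))"
      if "a \<le> r i" "b \<le> m r i" for a b
      using i that by (auto simp: rect_value_def phi_inv_def indices_def)
    obtain a' b' where [simp]: "a = Suc a'" "b = Suc b'"
      using ab by (metis Suc_le_D One_nat_def)
    \<comment> \<open>This is the product for (a, b) without its factor j = 0. It cancels in the
      quotient that defines \<open>phi_z\<close>, and only z (i, a, b) remains.\<close>
    have nz: "(\<Prod>j<min a' b'. z (i, a' - j, b' - j) / phi_q q (i - 1)) \<noteq> 0"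
      using Q torus_nonzero[OF z indices_diagonal[OF True, of "Suc j" for j]] by simp
    show ?thesis
      unfolding phi_z_eq[OF True] using ab nz Q
      by (simp add: val prod.lessThan_Suc_shift del: prod.lessThan_Suc)
  next
    case False
    then have "z (i, a, b) = undefined"
      using z by (auto simp: torus_def PiE_def extensional_def)
    then show ?thesis
      using False by (simp add: phi_z_def)
  qed
qed

lemma phi_z_torus:
  assumes q: "\<forall>i\<in>{1..\<rho>}. q i \<noteq> 0" and x: "x \<in> torus (indices \<rho> r)"
  shows "phi_z \<rho> r q x \<in> torus (indices \<rho> r)"
proof -
  have "phi_z \<rho> r q x (i, a, b) \<noteq> 0" if "(i, a, b) \<in> indices \<rho> r" for i a b
    using that rect_value_nonzero[OF x, of i] phi_q_nonzero_index[OF q that]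
    by (simp add: phi_z_eq) (auto simp: indices_def)
  then show ?thesis
    unfolding torus_def PiE_def by (auto simp: phi_z_def)
qed

lemma phi_inv_torus:
  assumes q: "\<forall>i\<in>{1..\<rho>}. q i \<noteq> 0" and z: "z \<in> torus (indices \<rho> r)"
  shows "phi_inv \<rho> r q z \<in> torus (indices \<rho> r)"
proof -
  have "phi_inv \<rho> r q z (i, a, b) \<noteq> 0" if "(i, a, b) \<in> indices \<rho> r" for i a b
    using that torus_nonzero[OF z indices_diagonal[OF that]] phi_q_nonzero_index[OF q that]
    by (simp add: phi_inv_def)
  then show ?thesis
    unfolding torus_def PiE_def by (auto simp: phi_inv_def)
qed

lemma torus_iso_phi:
  assumes q: "\<forall>i\<in>{1..\<rho>}. q i \<noteq> 0"
  shows "torus_iso (indices \<rho> r) (indices \<rho> r) (phi_z \<rho> r q)"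
proof -
  let ?I = "indices \<rho> r"
  have bij: "bij_betw (phi_z \<rho> r q) (torus ?I) (torus ?I)"
    by (rule bij_betw_byWitness[where f' = "phi_inv \<rho> r q"])
      (use q in \<open>auto simp: phi_inv_phi phi_z_phi_inv phi_z_torus phi_inv_torus\<close>)
  have inv: "the_inv_into (torus ?I) (phi_z \<rho> r q) z = phi_inv \<rho> r q z" if "z \<in> torus ?I" for z
    using that bij q by (intro the_inv_into_f_eq) (auto simp: bij_betw_def phi_z_phi_inv phi_inv_torus)
  have "laurent_on_torus ?I (\<lambda>x. phi_z \<rho> r q x (i, a, b))" if *: "(i, a, b) \<in> ?I" for i a b
  proof (rule laurent_on_torus_monomial[where c = "phi_q q (i - 1)"])
    show "laurent_monomial ?I (\<lambda>x. rect_value x i a b / rect_value x i (a - 1) (b - 1))"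
      using * by (intro laurent_monomial_divide laurent_monomial_rect_value) (auto simp: indices_def)
  qed (use * in \<open>simp add: phi_z_eq\<close>)
  moreover have "laurent_on_torus ?I (\<lambda>z. the_inv_into (torus ?I) (phi_z \<rho> r q) z (i, a, b))"
    if *: "(i, a, b) \<in> ?I" for i a b
  proof (rule laurent_on_torus_monomial)
    show "laurent_monomial ?I (\<lambda>z. \<Prod>j<min a b. z (i, a - j, b - j))"
      using * by (intro laurent_monomial_prod laurent_monomial_coordinate finite_indices) (auto simp: indices_def)
    show "the_inv_into (torus ?I) (phi_z \<rho> r q) z (i, a, b) =
        inverse (phi_q q (i - 1) ^ min a b) * (\<Prod>j<min a b. z (i, a - j, b - j))"
      if "z \<in> torus ?I" for z
      using that * by (simp add: inv phi_inv_def prod_dividef divide_inverse mult.commute power_inverse)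
  qed
  ultimately show ?thesis
    using bij unfolding torus_iso_def by force
qed

section \<open>The arrows of the ladder diagram\<close>

locale flag_type =
  fixes \<rho> :: nat and r :: "nat \<Rightarrow> nat"
  assumes r_decreasing: "\<And>i. i \<le> \<rho> \<Longrightarrow> r (i + 1) < r i"
    and r_last: "r (\<rho> + 1) = 0"
begin

text \<open>Column \<open>offset (i - 1) + b\<close> of the ladder diagram is column \<open>b\<close> of block \<open>i\<close>, and row
  \<open>offset i + a\<close> is its row \<open>a\<close>.\<close>

definition offset :: "nat \<Rightarrow> nat" where
  "offset i = r 0 - r i"

lemma r_mono: "i \<le> j \<Longrightarrow> j \<le> \<rho> + 1 \<Longrightarrow> r j \<le> r i"
proof (induction j rule: dec_induct)
  case (step j)
  then show ?case using r_decreasing[of j] by simp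
qed simp

lemma r_eq: "i \<le> \<rho> + 1 \<Longrightarrow> r i = r 0 - offset i"
  using r_mono[of 0 i] by (simp add: offset_def)

lemma offset_less: "i \<le> \<rho> \<Longrightarrow> offset i < offset (i + 1)"
  using r_decreasing[of i] r_mono[of 0 i] by (simp add: offset_def)

lemma offset_strict_mono: "i < j \<Longrightarrow> j \<le> \<rho> + 1 \<Longrightarrow> offset i < offset j"
proof (induction j)
  case (Suc j)
  then show ?case using offset_less[of j] by (cases "i = j") auto
qed simp

lemma offset_pred_less: "1 \<le> i \<Longrightarrow> i \<le> \<rho> + 1 \<Longrightarrow> offset (i - 1) < offset i"
  by (intro offset_strict_mono) auto

lemma offset_mono: "i \<le> j \<Longrightarrow> j \<le> \<rho> + 1 \<Longrightarrow> offset i \<le> offset j"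
  using offset_strict_mono[of i j] by (cases "i = j") auto

lemma offset_inj: "i \<le> \<rho> + 1 \<Longrightarrow> j \<le> \<rho> + 1 \<Longrightarrow> offset i = offset j \<Longrightarrow> i = j"
  using offset_strict_mono[of i j] offset_strict_mono[of j i] by (cases i j rule: linorder_cases) auto

lemma m_eq: "1 \<le> i \<Longrightarrow> i \<le> \<rho> \<Longrightarrow> m r i = offset i - offset (i - 1)"
proof -
  assume "1 \<le> i" "i \<le> \<rho>"
  then have "r i \<le> r (i - 1)" "r (i - 1) \<le> r 0"
    by (intro r_mono; simp)+
  then show ?thesis
    by (simp add: m_def offset_def)
qed

lemma offset_0 [simp]: "offset 0 = 0"
  by (simp add: offset_def)

lemma offset_column:
  assumes "(i, a, b) \<in> indices \<rho> r"
  shows "offset (i - 1) < offset (i - 1) + b" "offset (i - 1) + b \<le> offset i"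
  using assms offset_pred_less[of i] m_eq[of i] by (auto simp: indices_def)

lemma column_block:
  assumes "offset (i - 1) < x" "x \<le> offset i" "offset (j - 1) < x" "x \<le> offset j"
    and "1 \<le> i" "i \<le> \<rho> + 1" "1 \<le> j" "j \<le> \<rho> + 1"
  shows "i = j"
proof (cases i j rule: linorder_cases)
  case less
  then show ?thesis using offset_mono[of i "j - 1"] assms by linarith
next
  case greater
  then show ?thesis using offset_mono[of j "i - 1"] assms by linarith
qed

section \<open>Adjacent positions in the ladder diagram\<close>

definition adjacent :: "nat \<times> nat \<Rightarrow> nat \<times> nat \<Rightarrow> bool" where
  "adjacent u v \<longleftrightarrow> v = (fst u + 1, snd u) \<or> v = (fst u, snd u + 1)"

lemma position_Box: "position r (Box i a b) = (offset (i - 1) + b, offset i + a)"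
  by (simp add: offset_def)

lemma position_Ext: "position r (Ext i) = (offset i + 1, offset (i + 1))"
  by (simp add: offset_def)

text \<open>The column of the head determines its block. A vertical step stays in the block; a
  horizontal one leaves it only from the last column, and there the row number drops by r_i -
  r_{i+1}, since the top row of block i+1 lies that much lower.\<close>

lemma adjacent_Box_Box:
  assumes I: "(i, a, b) \<in> indices \<rho> r" and J: "(j, a', b') \<in> indices \<rho> r"
  shows "adjacent (position r (Box i a b)) (position r (Box j a' b')) \<longleftrightarrow>
    (j = i \<and> a' = a \<and> b' = b + 1) \<or> (j = i \<and> a' = a + 1 \<and> b' = b) \<or>
    (j = i + 1 \<and> b = m r i \<and> b' = 1 \<and> a = r i - r (i + 1) + a')"
    (is "?L \<longleftrightarrow> ?R")
proof -
  have i: "1 \<le> i" "i \<le> \<rho>" and j: "1 \<le> j" "j \<le> \<rho>" and ab: "1 \<le> a" "1 \<le> b" "1 \<le> a'" "1 \<le> b'"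
    using I J by (auto simp: indices_def)
  note col = offset_column[OF I] offset_column[OF J]
  have d: "r i - r (i + 1) = offset (i + 1) - offset i"
    using r_eq[of i] r_eq[of "i + 1"] offset_less[of i] r_mono[of 0 i] r_mono[of 0 "i+1"] i by (simp add: offset_def)
  show ?thesis
  proof
    assume ?L
    then consider (hor) "offset (j - 1) + b' = offset (i - 1) + b + 1" "offset j + a' = offset i + a"
      | (ver) "offset (j - 1) + b' = offset (i - 1) + b" "offset j + a' = offset i + a + 1"
      by (auto simp: adjacent_def position_Box simp del: position.simps)
    then show ?R
    proof cases
      case hor
      show ?thesis
      proof (cases "offset (i - 1) + b + 1 \<le> offset i")
        case True
        then have "i = j"
          using hor col i j by (intro column_block[of _ "offset (i - 1) + b + 1"]) auto
        then show ?thesis using hor by simp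
      next
        case False
        then have eq: "offset (i - 1) + b = offset i"
          using col by linarith
        have "i + 1 = j"
          using hor col i j eq offset_less[of i]
          by (intro column_block[of _ "offset i + 1"]) (auto simp: Suc_le_eq)
        then show ?thesis using hor eq d m_eq[of i] i offset_less[of i] offset_pred_less[of i] by auto
      qed
    next
      case ver
      then have "i = j"
        using col i j by (intro column_block[of _ "offset (i - 1) + b"]) auto
      then show ?thesis using ver by simp
    qed
  next
    assume ?R
    then show ?L
      using d m_eq[of i] i offset_less[of i] offset_pred_less[of i]
      by (auto simp: adjacent_def position_Box simp del: position.simps)
  qed
qed

text \<open>An external vertex lies above all boxes in its column, so it can only be reached
  horizontally, from the last column of the block with the same index.\<close>

lemma adjacent_Box_Ext:
  assumes I: "(i, a, b) \<in> indices \<rho> r" and e: "e \<le> \<rho>"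
  shows "adjacent (position r (Box i a b)) (position r (Ext e)) \<longleftrightarrow>
    e = i \<and> b = m r i \<and> a = r i - r (i + 1)"
    (is "?L \<longleftrightarrow> ?R")
proof -
  have i: "1 \<le> i" "i \<le> \<rho>" and ab: "1 \<le> a" "1 \<le> b"
    using I by (auto simp: indices_def)
  note col = offset_column[OF I]
  have d: "r i - r (i + 1) = offset (i + 1) - offset i"
    using r_mono[of 0 i] r_mono[of 0 "i+1"] r_mono[of i "i + 1"] i by (simp add: offset_def)
  show ?thesis
  proof
    assume ?L
    then consider (hor) "offset e = offset (i - 1) + b" "offset (e + 1) = offset i + a"
      | (ver) "offset e + 1 = offset (i - 1) + b" "offset (e + 1) = offset i + a + 1"
      by (auto simp: adjacent_def position_Ext position_Box simp del: position.simps)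
    then show ?R
    proof cases
      case hor
      then have "e \<noteq> 0"
        using col by (cases "e = 0") auto
      then have "i = e"
        using hor col e i offset_pred_less[of e] by (intro column_block[of _ "offset e"]) auto
      then show ?thesis
        using hor d m_eq[of i] i by auto
    next
      case ver
      then have "i = e + 1"
        using col e i offset_less[of e] by (intro column_block[of _ "offset e + 1"]) auto
      then show ?thesis
        using ver(2) by simp
    qed
  next
    assume ?R
    then show ?L
      using d m_eq[of i] i offset_less[of i] offset_pred_less[of i]
      by (auto simp: adjacent_def position_Ext position_Box simp del: position.simps)
  qed
qed

text \<open>A box in the row of \<open>Ext e\<close> belongs to a block of index at most e, all of
  whose columns lie to the left. Only the box directly below remains.\<close>

lemma adjacent_Ext_Box:
  assumes I: "(i, a, b) \<in> indices \<rho> r" and e: "e \<le> \<rho>"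
  shows "adjacent (position r (Ext e)) (position r (Box i a b)) \<longleftrightarrow> i = e + 1 \<and> a = 1 \<and> b = 1"
    (is "?L \<longleftrightarrow> ?R")
proof -
  have i: "1 \<le> i" "i \<le> \<rho>" and ab: "1 \<le> a" "1 \<le> b"
    using I by (auto simp: indices_def)
  note col = offset_column[OF I]
  show ?thesis
  proof
    assume ?L
    then consider (hor) "offset (i - 1) + b = offset e + 2" "offset i + a = offset (e + 1)"
      | (ver) "offset (i - 1) + b = offset e + 1" "offset i + a = offset (e + 1) + 1"
      by (auto simp: adjacent_def position_Ext position_Box simp del: position.simps)
    then show ?R
    proof cases
      case hor
      then have "\<not> e + 1 \<le> i"
        using offset_mono[of "e + 1" i] i ab by auto
      then have "offset i \<le> offset e"
        using e by (intro offset_mono) auto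
      then show ?thesis
        using hor col by simp
    next
      case ver
      then have "i = e + 1"
        using col e i offset_less[of e] by (intro column_block[of _ "offset e + 1"]) auto
      then show ?thesis
        using ver by simp
    qed
  next
    assume ?R
    then show ?L
      by (auto simp: adjacent_def position_Ext position_Box simp del: position.simps)
  qed
qed

text \<open>Adjacent positions share one coordinate, and either coordinate already determines the
  index of an external vertex.\<close>

lemma not_adjacent_Ext_Ext:
  assumes "e \<le> \<rho>" "e' \<le> \<rho>"
  shows "\<not> adjacent (position r (Ext e)) (position r (Ext e'))"
proof
  assume "adjacent (position r (Ext e)) (position r (Ext e'))"
  then have "offset e' = offset e \<and> offset (e' + 1) = offset (e + 1) + 1 \<or>
      offset e' = offset e + 1 \<and> offset (e' + 1) = offset (e + 1)"
    by (auto simp: adjacent_def position_Ext simp del: position.simps)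
  moreover have "e' = e" if "offset e' = offset e"
    using offset_inj[OF _ _ that] assms by simp
  moreover have "e' + 1 = e + 1" if "offset (e' + 1) = offset (e + 1)"
    using offset_inj[OF _ _ that] assms by simp
  ultimately show False
    by (metis add_cancel_left_right add_right_imp_eq one_neq_zero)
qed

text \<open>The head of the arrow leaving block i through its last column in row a. Only rows from
  r_i - r_{i+1} on have one: the topmost leads to \<open>Ext i\<close>, the lower ones into the
  first column of block i+1.\<close>

definition exit_target :: "nat \<Rightarrow> nat \<Rightarrow> vertex" where
  "exit_target i a = (if a = r i - r (i + 1) then Ext i else Box (i + 1) (a - (r i - r (i + 1))) 1)"

lemma m_pos: "1 \<le> i \<Longrightarrow> i \<le> \<rho> \<Longrightarrow> 1 \<le> m r i"
  using m_eq[of i] offset_pred_less[of i] by simp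

lemma r_pos: "i \<le> \<rho> \<Longrightarrow> 1 \<le> r i"
  using r_decreasing[of i] by simp

text \<open>The four families are the arrows entering a block, the horizontal and the vertical ones
  inside a block, and those leaving it through its last column.\<close>

lemma arrows_eq:
  "arrows \<rho> r =
    (\<lambda>i. (Ext (i - 1), Box i 1 1)) ` {1..\<rho>} \<union>
    (\<lambda>(i, a, b). (Box i a b, Box i a (b + 1))) ` (SIGMA i:{1..\<rho>}. {1..r i} \<times> {1..<m r i}) \<union>
    (\<lambda>(i, a, b). (Box i a b, Box i (a + 1) b)) ` (SIGMA i:{1..\<rho>}. {1..<r i} \<times> {1..m r i}) \<union>
    (\<lambda>(i, a). (Box i a (m r i), exit_target i a)) ` (SIGMA i:{1..\<rho>}. {r i - r (i + 1)..r i})"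
    (is "_ = ?E \<union> ?H \<union> ?V \<union> ?X")
proof -
  have arrow: "(t, h) \<in> arrows \<rho> r \<longleftrightarrow>
      t \<in> vertices \<rho> r \<and> h \<in> vertices \<rho> r \<and> adjacent (position r t) (position r h)" for t h
    by (simp add: arrows_def adjacent_def)
  have "?E \<union> ?H \<union> ?V \<union> ?X \<subseteq> arrows \<rho> r"
  proof -
    have "(Ext (i - 1), Box i 1 1) \<in> arrows \<rho> r" if "i \<in> {1..\<rho>}" for i
    proof -
      have "(i, 1, 1) \<in> indices \<rho> r"
        using that m_pos[of i] r_pos[of i] by (auto simp: indices_def)
      then show ?thesis
        using that adjacent_Ext_Box[of i 1 1 "i - 1"] by (auto simp: arrow vertices_def)
    qed
    moreover have "(Box i a b, Box i a (b + 1)) \<in> arrows \<rho> r"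
      if "i \<in> {1..\<rho>}" "a \<in> {1..r i}" "b \<in> {1..<m r i}" for i a b
    proof -
      have "(i, a, b) \<in> indices \<rho> r" "(i, a, b + 1) \<in> indices \<rho> r"
        using that by (auto simp: indices_def)
      then show ?thesis
        using adjacent_Box_Box[of i a b i a "b + 1"] by (auto simp: arrow vertices_def)
    qed
    moreover have "(Box i a b, Box i (a + 1) b) \<in> arrows \<rho> r"
      if "i \<in> {1..\<rho>}" "a \<in> {1..<r i}" "b \<in> {1..m r i}" for i a b
    proof -
      have "(i, a, b) \<in> indices \<rho> r" "(i, a + 1, b) \<in> indices \<rho> r"
        using that by (auto simp: indices_def)
      then show ?thesis
        using adjacent_Box_Box[of i a b i "a + 1" b] by (auto simp: arrow vertices_def)
    qed
    moreover have "(Box i a (m r i), exit_target i a) \<in> arrows \<rho> r"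
      if "i \<in> {1..\<rho>}" "a \<in> {r i - r (i + 1)..r i}" for i a
    proof -
      have I: "(i, a, m r i) \<in> indices \<rho> r"
        using that m_pos[of i] r_decreasing[of i] by (auto simp: indices_def)
      show ?thesis
      proof (cases "a = r i - r (i + 1)")
        case True
        then show ?thesis
          using that I adjacent_Box_Ext[OF I, of i] by (auto simp: arrow vertices_def exit_target_def)
      next
        case False
        \<comment> \<open>In the last block the range of exit rows is the single row r_\<rho>,
          already covered by the other case.\<close>
        then have "i \<noteq> \<rho>"
          using that r_last by auto
        then have J: "(i + 1, a - (r i - r (i + 1)), 1) \<in> indices \<rho> r"
          using that False m_pos[of "i + 1"] r_decreasing[of i] by (auto simp: indices_def)
        then show ?thesis
          using that I adjacent_Box_Box[OF I J] False
          by (auto simp: arrow vertices_def exit_target_def)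
      qed
    qed
    ultimately show ?thesis
      by auto
  qed
  moreover have "(t, h) \<in> ?E \<union> ?H \<union> ?V \<union> ?X" if "(t, h) \<in> arrows \<rho> r" for t h
  proof -
    have th: "t \<in> vertices \<rho> r" "h \<in> vertices \<rho> r" and adj: "adjacent (position r t) (position r h)"
      using that by (auto simp: arrow)
    show ?thesis
    proof (cases t)
      case t: (Box i a b)
      then have I: "(i, a, b) \<in> indices \<rho> r"
        using th by (auto simp: vertices_def)
      show ?thesis
      proof (cases h)
        case h: (Box j a' b')
        then have J: "(j, a', b') \<in> indices \<rho> r"
          using th by (auto simp: vertices_def)
        consider "j = i" "a' = a" "b' = b + 1" | "j = i" "a' = a + 1" "b' = b"
          | "j = i + 1" "b = m r i" "b' = 1" "a = r i - r (i + 1) + a'"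
          using adj adjacent_Box_Box[OF I J] t h by auto
        then show ?thesis
        proof cases
          case 1
          then have "(t, h) \<in> ?H"
            using I J t h by (force simp: indices_def)
          then show ?thesis by blast
        next
          case 2
          then have "(t, h) \<in> ?V"
            using I J t h by (force simp: indices_def)
          then show ?thesis by blast
        next
          case 3
          then have "(t, h) = (Box i a (m r i), exit_target i a)"
            using t h J by (simp add: exit_target_def indices_def)
          moreover have "(i, a) \<in> (SIGMA i:{1..\<rho>}. {r i - r (i + 1)..r i})"
            using 3 I by (simp add: indices_def)
          ultimately have "(t, h) \<in> ?X"
            by force
          then show ?thesis by blast
        qed
      next
        case h: (Ext e)
        then have "e \<le> \<rho>"
          using th by (auto simp: vertices_def)
        then have "e = i" "b = m r i" "a = r i - r (i + 1)"
          using adj adjacent_Box_Ext[OF I] t h by auto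
        then have "(t, h) = (Box i a (m r i), exit_target i a)"
            "(i, a) \<in> (SIGMA i:{1..\<rho>}. {r i - r (i + 1)..r i})"
          using t h I by (simp_all add: exit_target_def indices_def)
        then have "(t, h) \<in> ?X"
          by force
        then show ?thesis by blast
      qed
    next
      case t: (Ext e)
      then have e: "e \<le> \<rho>"
        using th by (auto simp: vertices_def)
      show ?thesis
      proof (cases h)
        case h: (Box i a b)
        then have I: "(i, a, b) \<in> indices \<rho> r"
          using th by (auto simp: vertices_def)
        have "i = e + 1" "a = 1" "b = 1"
          using adj adjacent_Ext_Box[OF I e] t h by auto
        then have "(t, h) \<in> ?E"
          using t h I by (force simp: indices_def)
        then show ?thesis by blast
      next
        case h: (Ext e')
        then have "e' \<le> \<rho>"
          using th by (auto simp: vertices_def)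
        then show ?thesis
          using not_adjacent_Ext_Ext[OF e] adj t h by blast
      qed
    qed
  qed
  ultimately show ?thesis
    by (intro subset_antisym) auto
qed

lemma W_T_eq:
  "W_T \<rho> r qt z = (\<Sum>i = 1..\<rho>.
     z (i, 1, 1) / vertex_value qt z (Ext (i - 1))
     + (\<Sum>a = 1..r i. \<Sum>b = 1..<m r i. z (i, a, b + 1) / z (i, a, b))
     + (\<Sum>a = 1..<r i. \<Sum>b = 1..m r i. z (i, a + 1, b) / z (i, a, b))
     + (\<Sum>a = r i - r (i + 1)..r i. vertex_value qt z (exit_target i a) / z (i, a, m r i)))"
proof -
  let ?f = "\<lambda>(t, h). vertex_value qt z h / vertex_value qt z t"
  let ?e = "\<lambda>i. (Ext (i - 1), Box i 1 1)"
  let ?h = "\<lambda>(i, a, b). (Box i a b, Box i a (b + 1))"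
  let ?v = "\<lambda>(i, a, b). (Box i a b, Box i (a + 1) b)"
  let ?x = "\<lambda>(i, a). (Box i a (m r i), exit_target i a)"
  let ?H = "SIGMA i:{1..\<rho>}. {1..r i} \<times> {1..<m r i}"
  let ?V = "SIGMA i:{1..\<rho>}. {1..<r i} \<times> {1..m r i}"
  let ?X = "SIGMA i:{1..\<rho>}. {r i - r (i + 1)..r i}"
  \<comment> \<open>The families are told apart by an external tail, by a change of block, and
    otherwise by whether row or column moves.\<close>
  have "sum ?f (arrows \<rho> r) = sum ?f (?e ` {1..\<rho>}) + sum ?f (?h ` ?H) + sum ?f (?v ` ?V) + sum ?f (?x ` ?X)"
    unfolding arrows_eq
    by (subst sum.union_disjoint; (auto simp: exit_target_def split: if_splits)?)+
  also have "sum ?f (?e ` {1..\<rho>}) = (\<Sum>i = 1..\<rho>. z (i, 1, 1) / vertex_value qt z (Ext (i - 1)))"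
    by (subst sum.reindex) (auto simp: inj_on_def intro!: sum.cong simp del: vertex_value.simps(2))
  also have "sum ?f (?h ` ?H) = (\<Sum>i = 1..\<rho>. \<Sum>a = 1..r i. \<Sum>b = 1..<m r i. z (i, a, b + 1) / z (i, a, b))"
    by (subst sum.reindex) (auto simp: inj_on_def sum.Sigma intro!: sum.cong)
  also have "sum ?f (?v ` ?V) = (\<Sum>i = 1..\<rho>. \<Sum>a = 1..<r i. \<Sum>b = 1..m r i. z (i, a + 1, b) / z (i, a, b))"
    by (subst sum.reindex) (auto simp: inj_on_def sum.Sigma intro!: sum.cong)
  also have "sum ?f (?x ` ?X) = (\<Sum>i = 1..\<rho>. \<Sum>a = r i - r (i + 1)..r i.
      vertex_value qt z (exit_target i a) / z (i, a, m r i))"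
    by (subst sum.reindex) (auto simp: inj_on_def sum.Sigma intro!: sum.cong)
  finally show ?thesis
    unfolding W_T_def by (simp only: sum.distrib)
qed

end

section \<open>The superpotential in the rectangles chart\<close>

context flag_type
begin

lemma r_pred_eq: "1 \<le> i \<Longrightarrow> i \<le> \<rho> \<Longrightarrow> r (i - 1) = r i + m r i"
  using r_mono[of "i - 1" i] by (simp add: m_def)

lemma p_eq:
  assumes "i \<in> {1..\<rho>}"
  shows "p \<rho> r y i \<mu> = pluecker (r i + m r i) (r i) (y i) \<mu>"
  using assms r_pred_eq[of i] by (simp add: p_def)

lemma rect_locus_iff:
  "y \<in> rect_locus \<rho> r \<longleftrightarrow> y \<in> extensional {1..\<rho>} \<and> (\<forall>i\<in>{1..\<rho>}. y i \<in> pluecker_chart (r i) (m r i) \<and>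
    (\<forall>a b. 1 \<le> a \<longrightarrow> a \<le> r i \<longrightarrow> 1 \<le> b \<longrightarrow> b \<le> m r i \<longrightarrow>
      pluecker (r i + m r i) (r i) (y i) (rect a b) \<noteq> 0))" (is "_ \<longleftrightarrow> ?R")
proof
  assume y: "y \<in> rect_locus \<rho> r"
  then have "y \<in> extensional {1..\<rho>}"
    by (simp add: rect_locus_def Y_open_def Y_def PiE_def)
  moreover have "y i \<in> pluecker_chart (r i) (m r i)" if "i \<in> {1..\<rho>}" for i
  proof -
    have "y i \<in> Gr (r (i - 1)) (m r i)"
      using y that by (auto simp: rect_locus_def Y_open_def Y_def dest: PiE_mem)
    moreover have "\<forall>A\<in>y i. maximal_minor (r (i - 1)) (r i) A empty_part \<noteq> 0"
      using y that by (simp add: rect_locus_def Y_open_def)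
    ultimately show ?thesis
      using that r_pred_eq[of i] by (simp add: pluecker_chart_def)
  qed
  moreover have "pluecker (r i + m r i) (r i) (y i) (rect a b) \<noteq> 0"
    if "i \<in> {1..\<rho>}" "1 \<le> a" "a \<le> r i" "1 \<le> b" "b \<le> m r i" for i a b
  proof -
    have "(i, a, b) \<in> indices \<rho> r"
      using that by (simp add: indices_def)
    then have "p \<rho> r y i (rect a b) \<noteq> 0"
      using y by (auto simp: rect_locus_def)
    then show ?thesis
      using p_eq that by simp
  qed
  ultimately show ?R
    by blast
next
  assume R: ?R
  have chart: "y i \<in> pluecker_chart (r i) (m r i)" if "i \<in> {1..\<rho>}" for i
    using R that by blast
  have nz: "p \<rho> r y i (rect a b) \<noteq> 0" if "i \<in> {1..\<rho>}" "a \<le> r i" "b \<le> m r i" for i a b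
  proof (cases "a = 0 \<or> b = 0")
    case True
    then show ?thesis
      using pluecker_empty[OF chart] p_eq that by auto
  next
    case False
    then show ?thesis
      using R that p_eq by simp
  qed
  have "y \<in> Y \<rho> r"
    using R r_pred_eq by (auto simp: Y_def PiE_def pluecker_chart_def)
  moreover have "maximal_minor (r (i - 1)) (r i) A empty_part \<noteq> 0" if "i \<in> {1..\<rho>}" "A \<in> y i" for i A
    using chart[OF that(1)] r_pred_eq[of i] that by (simp add: pluecker_chart_def)
  \<comment> \<open>The maximal rectangles include the empty one, of width 0, where the coordinate
    is 1.\<close>
  moreover have "p \<rho> r y i (rect a b) \<noteq> 0"
    if "i \<in> {1..\<rho>}" "(a, b) \<in> max_rects (r (i - 1)) (r i)" for i a b
    using that r_pred_eq[of i] by (intro nz) (auto simp: max_rects_def)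
  moreover have "p \<rho> r y i (rect a b) \<noteq> 0" if "(i, a, b) \<in> indices \<rho> r" for i a b
    using that by (intro nz) (auto simp: indices_def)
  ultimately show "y \<in> rect_locus \<rho> r"
    unfolding rect_locus_def Y_open_def by blast
qed

lemma rect_coords_apply:
  assumes "i \<in> {1..\<rho>}" "1 \<le> a" "a \<le> r i" "1 \<le> b" "b \<le> m r i"
  shows "rect_coords \<rho> r y (i, a, b) = pluecker (r i + m r i) (r i) (y i) (rect a b)"
  using assms p_eq[of i] by (simp add: rect_coords_def indices_def)

lemma rect_coords_bij: "bij_betw (rect_coords \<rho> r) (rect_locus \<rho> r) (torus (indices \<rho> r))"
proof (rule bij_betw_imageI)
  show "inj_on (rect_coords \<rho> r) (rect_locus \<rho> r)"
  proof (rule inj_onI)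
    fix y y' assume y: "y \<in> rect_locus \<rho> r" and y': "y' \<in> rect_locus \<rho> r"
      and eq: "rect_coords \<rho> r y = rect_coords \<rho> r y'"
    have "y i = y' i" if "i \<in> {1..\<rho>}" for i
      using y y' that rect_coords_apply[OF that, of _ _ y] rect_coords_apply[OF that, of _ _ y'] eq
      by (intro pluecker_chart_inj[of "y i" "r i" "m r i" "y' i"]) (auto simp: rect_locus_iff)
    then show "y = y'"
      using y y' by (intro extensionalityI[of _ "{1..\<rho>}"]) (auto simp: rect_locus_iff)
  qed
  show "rect_coords \<rho> r ` rect_locus \<rho> r = torus (indices \<rho> r)"
  proof (intro subset_antisym subsetI)
    fix x assume "x \<in> rect_coords \<rho> r ` rect_locus \<rho> r"
    then obtain y where "y \<in> rect_locus \<rho> r" "x = rect_coords \<rho> r y"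
      by blast
    then show "x \<in> torus (indices \<rho> r)"
      by (auto simp: rect_locus_def torus_def PiE_def rect_coords_def)
  next
    fix x assume x: "x \<in> torus (indices \<rho> r)"
    have "\<exists>X. X \<in> pluecker_chart (r i) (m r i) \<and> (\<forall>a b. 1 \<le> a \<longrightarrow> a \<le> r i \<longrightarrow> 1 \<le> b \<longrightarrow> b \<le> m r i \<longrightarrow>
        pluecker (r i + m r i) (r i) X (rect a b) = x (i, a, b))" if "i \<in> {1..\<rho>}" for i
    proof -
      have "x (i, a, b) \<noteq> 0" if "1 \<le> a" "a \<le> r i" "1 \<le> b" "b \<le> m r i" for a b
        using \<open>i \<in> {1..\<rho>}\<close> that by (intro torus_nonzero[OF x]) (auto simp: indices_def)
      then show ?thesis
        using pluecker_chart_surj[of "r i" "m r i" "\<lambda>a b. x (i, a, b)"] by metis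
    qed
    then obtain X where X: "\<And>i. i \<in> {1..\<rho>} \<Longrightarrow> X i \<in> pluecker_chart (r i) (m r i)"
      "\<And>i a b. \<lbrakk>i \<in> {1..\<rho>}; 1 \<le> a; a \<le> r i; 1 \<le> b; b \<le> m r i\<rbrakk> \<Longrightarrow>
        pluecker (r i + m r i) (r i) (X i) (rect a b) = x (i, a, b)"
      by metis
    have "rect_coords \<rho> r (restrict X {1..\<rho>}) (i, a, b) = x (i, a, b)" for i a b
    proof (cases "(i, a, b) \<in> indices \<rho> r")
      case True
      then show ?thesis
        by (subst rect_coords_apply) (auto simp: indices_def X)
    next
      case False
      then show ?thesis
        using x by (auto simp: rect_coords_def torus_def PiE_def extensional_def)
    qed
    then have "x = rect_coords \<rho> r (restrict X {1..\<rho>})"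
      by (intro ext) auto
    moreover have "restrict X {1..\<rho>} \<in> rect_locus \<rho> r"
      using x unfolding rect_locus_iff
      by (auto simp: X dest: torus_nonzero[of x _ "(i, a, b)" for i a b] simp: indices_def)
    ultimately show "x \<in> rect_coords \<rho> r ` rect_locus \<rho> r"
      by blast
  qed
qed

lemma sum_max_rects:
  assumes "0 < k"
  shows "sum f (max_rects (k + d) k) = (\<Sum>b<d. f (k, b)) + (\<Sum>a = 1..k. f (a, d))"
proof -
  have "max_rects (k + d) k = (\<lambda>b. (k, b)) ` {..<d} \<union> (\<lambda>a. (a, d)) ` {1..k}"
    by (auto simp: max_rects_def)
  moreover have "sum f \<dots> = sum f ((\<lambda>b. (k, b)) ` {..<d}) + sum f ((\<lambda>a. (a, d)) ` {1..k})"
    by (rule sum.union_disjoint) auto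
  ultimately show ?thesis
    by (simp add: sum.reindex inj_on_def)
qed

text \<open>The four summands are arranged to face those of \<open>W_T_eq\<close>: the empty
  rectangle, the remaining tall rectangles, the wide rectangles, and the q-terms.\<close>

lemma W_R_eq:
  assumes x: "x \<in> torus (indices \<rho> r)"
  defines "R \<equiv> rect_value x"
  shows "W_R \<rho> r q x = (\<Sum>i = 1..\<rho>.
     R i 1 1
     + (\<Sum>a = 1..r i. \<Sum>b = 1..<m r i. R i a (b + 1) * R i (a - 1) (b - 1) / (R i (a - 1) b * R i a b))
     + (\<Sum>a = 1..<r i. \<Sum>b = 1..m r i. R i (a + 1) b * R i (a - 1) (b - 1) / (R i a (b - 1) * R i a b))
     + (\<Sum>a = r i - r (i + 1)..r i.
          q i * (R i (a - 1) (m r i - 1) * R (i + 1) (a - (r i - r (i + 1))) 1 / R i a (m r i))))"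
proof -
  define y where "y = rect_chart \<rho> r x"
  have y: "y \<in> rect_locus \<rho> r" and xy: "rect_coords \<rho> r y = x"
    using rect_coords_bij x unfolding y_def rect_chart_def
    by (auto simp: bij_betw_def the_inv_into_into f_the_inv_into_f)
  define P where "P i = p \<rho> r y i" for i
  have chart: "y i \<in> pluecker_chart (r i) (m r i)" if "i \<in> {1..\<rho>}" for i
    using y that by (simp add: rect_locus_iff)
  have P_rect: "P i (rect a b) = R i a b" if "i \<in> {1..\<rho>}" "a \<le> r i" "b \<le> m r i" for i a b
  proof (cases "a = 0 \<or> b = 0")
    case True
    then show ?thesis
      using pluecker_empty[OF chart] p_eq that by (auto simp: P_def R_def)
  next
    case False
    then show ?thesis
      using rect_coords_apply[of i a b y] xy p_eq that by (simp add: P_def R_def rect_value_def)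
  qed
  have Rnz: "R i a b \<noteq> 0" if "i \<in> {1..\<rho>}" "a \<le> r i" "b \<le> m r i" for i a b
    unfolding R_def using x that by (rule rect_value_nonzero)
  have P_col: "P i (rect_extra_col (r i) b) / R i (r i) b =
      (\<Sum>a = 1..r i. R i a (b + 1) * R i (a - 1) (b - 1) / (R i (a - 1) b * R i a b))"
    if i: "i \<in> {1..\<rho>}" and b: "1 \<le> b" "b < m r i" for i b
  proof -
    have "P i (rect_extra_col (r i) b) / P i (rect (r i) b) =
        (\<Sum>a = 1..r i. P i (rect a (b + 1)) * P i (rect (a - 1) (b - 1)) / (P i (rect (a - 1) b) * P i (rect a b)))"
      unfolding P_def p_eq[OF i]
      using y i b r_pos[of i] by (intro pluecker_extra_col_quotient) (auto simp: rect_locus_iff)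
    also have "\<dots> = (\<Sum>a = 1..r i. R i a (b + 1) * R i (a - 1) (b - 1) / (R i (a - 1) b * R i a b))"
      using i b by (intro sum.cong) (auto simp: P_rect)
    finally show ?thesis
      using i b by (simp add: P_rect)
  qed
  have P_row: "P i (rect_extra_row a (m r i)) / R i a (m r i) =
      (\<Sum>b = 1..m r i. R i (a + 1) b * R i (a - 1) (b - 1) / (R i a (b - 1) * R i a b))"
    if i: "i \<in> {1..\<rho>}" and a: "1 \<le> a" "a < r i" for i a
  proof -
    have "P i (rect_extra_row a (m r i)) / P i (rect a (m r i)) =
        (\<Sum>b = 1..m r i. P i (rect (a + 1) b) * P i (rect (a - 1) (b - 1)) / (P i (rect a (b - 1)) * P i (rect a b)))"
      unfolding P_def p_eq[OF i]
      using y i a m_pos[of i] by (intro pluecker_extra_row_quotient) (auto simp: rect_locus_iff)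
    also have "\<dots> = (\<Sum>b = 1..m r i. R i (a + 1) b * R i (a - 1) (b - 1) / (R i a (b - 1) * R i a b))"
      using i a by (intro sum.cong) (auto simp: P_rect)
    finally show ?thesis
      using i a by (simp add: P_rect)
  qed
  \<comment> \<open>For i = \<rho> only c = 0 is possible, and both sides take the conventional
    value 1.\<close>
  have P_column: "P (i + 1) (column c) = R (i + 1) c 1" if "i \<in> {1..\<rho>}" "c \<le> r (i + 1)" for i c
  proof (cases "i = \<rho>")
    case True
    then show ?thesis
      using that r_last by (simp add: P_def p_def R_def)
  next
    case False
    then show ?thesis
      using that m_pos[of "i + 1"] by (simp add: column_def P_rect)
  qed
  define Ex where "Ex i a = q i * (R i (a - 1) (m r i - 1) * R (i + 1) (a - (r i - r (i + 1))) 1 / R i a (m r i))" for i a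
  have G_tall: "(\<Sum>b<m r i. G \<rho> r q y i (r i, b) / P i (rect (r i) b)) = R i 1 1 +
      (\<Sum>a = 1..r i. \<Sum>b = 1..<m r i. R i a (b + 1) * R i (a - 1) (b - 1) / (R i (a - 1) b * R i a b))"
    if i: "i \<in> {1..\<rho>}" for i
  proof -
    \<comment> \<open>The tall rectangle of width 0 is empty, and adding a box to it gives p_box,
      the term of the arrow out of \<open>Ext (i - 1)\<close>.\<close>
    have "rect_extra_col (r i) 0 = rect 1 1"
      by (auto simp: rect_extra_col_def rect_def)
    then have zero: "G \<rho> r q y i (r i, 0) / P i (rect (r i) 0) = R i 1 1"
      using i P_rect[OF i, of 1 1] P_rect[OF i, of "r i" 0] m_pos[of i] r_pos[of i]
      by (simp add: G_def R_def flip: P_def)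
    have "(\<Sum>b<m r i. G \<rho> r q y i (r i, b) / P i (rect (r i) b)) =
        R i 1 1 + (\<Sum>b = 1..<m r i. G \<rho> r q y i (r i, b) / P i (rect (r i) b))"
      using m_pos[of i] i sum.atLeast_Suc_lessThan[of 0 "m r i" "\<lambda>b. G \<rho> r q y i (r i, b) / P i (rect (r i) b)"]
      by (simp only: zero lessThan_atLeast0) simp
    also have "(\<Sum>b = 1..<m r i. G \<rho> r q y i (r i, b) / P i (rect (r i) b)) = (\<Sum>b = 1..<m r i. \<Sum>a = 1..r i.
        R i a (b + 1) * R i (a - 1) (b - 1) / (R i (a - 1) b * R i a b))"
      using i P_col[OF i] by (intro sum.cong refl) (simp add: G_def P_rect flip: P_def)
    finally show ?thesis
      by (subst sum.swap)
  qed
  \<comment> \<open>One formula for the three wide cases of \<open>G\<close>: the quotient with an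
    extra row is missing at a = r_i, the q-term is missing for a < r_i - r_{i+1}, and the
    p^{i-1}_box term is always present.\<close>
  have G_wide: "G \<rho> r q y i (a, m r i) / P i (rect a (m r i)) =
      (if a \<in> {1..<r i} then \<Sum>b = 1..m r i. R i (a + 1) b * R i (a - 1) (b - 1) / (R i a (b - 1) * R i a b) else 0)
      + P (i - 1) box + (if a \<in> {r i - r (i + 1)..r i} then Ex i a else 0)"
    if i: "i \<in> {1..\<rho>}" and a: "1 \<le> a" "a \<le> r i" for i a
  proof -
    have nz: "R i a (m r i) \<noteq> 0"
      using i a by (intro Rnz) auto
    have col: "P (i + 1) (column (a - (r i - r (i + 1)))) = R (i + 1) (a - (r i - r (i + 1))) 1"
      using i a by (intro P_column) auto
    have small: "P i (rect (a - 1) (m r i - 1)) = R i (a - 1) (m r i - 1)"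
      using i a by (intro P_rect) auto
    have full: "P i (rect a (m r i)) = R i a (m r i)"
      using i a by (intro P_rect) auto
    have dec: "r (i + 1) < r i"
      using i by (intro r_decreasing) auto
    consider "a < r i - r (i + 1)" | "r i - r (i + 1) \<le> a" "a < r i" | "a = r i"
      using a by linarith
    then show ?thesis
    proof cases
      case 1
      then show ?thesis
        using a nz full P_row[OF i, of a] dec
        by (simp add: G_def Let_def add_divide_distrib flip: P_def)
    next
      case 2
      then show ?thesis
        using a nz full small col P_row[OF i, of a] dec
        by (simp add: G_def Let_def add_divide_distrib Ex_def mult.assoc flip: P_def)
    next
      case 3
      then have "\<not> r i < r i - r (i + 1)"
        by simp
      with 3 show ?thesis
        using nz full small col dec
        by (simp add: G_def Let_def add_divide_distrib Ex_def mult.assoc flip: P_def)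
    qed
  qed
  have inner: "(\<Sum>(a, b)\<in>max_rects (r (i - 1)) (r i). G \<rho> r q y i (a, b) / P i (rect a b)) =
      R i 1 1
      + (\<Sum>a = 1..r i. \<Sum>b = 1..<m r i. R i a (b + 1) * R i (a - 1) (b - 1) / (R i (a - 1) b * R i a b))
      + (\<Sum>a = 1..<r i. \<Sum>b = 1..m r i. R i (a + 1) b * R i (a - 1) (b - 1) / (R i a (b - 1) * R i a b))
      + of_nat (r i) * P (i - 1) box + (\<Sum>a = r i - r (i + 1)..r i. Ex i a)"
    if i: "i \<in> {1..\<rho>}" for i
  proof -
    have restr: "(\<Sum>a = 1..r i. if a \<in> S then f a else 0) = sum f S" if "S \<subseteq> {1..r i}"
      for f :: "nat \<Rightarrow> complex" and S
      using that by (simp add: Int_absorb1 flip: sum.inter_restrict)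
    have sub: "{1..<r i} \<subseteq> {1..r i}" "{r i - r (i + 1)..r i} \<subseteq> {1..r i}"
      using r_decreasing[of i] i by auto
    have "(\<Sum>a = 1..r i. G \<rho> r q y i (a, m r i) / P i (rect a (m r i))) =
        (\<Sum>a = 1..r i. (if a \<in> {1..<r i} then
            \<Sum>b = 1..m r i. R i (a + 1) b * R i (a - 1) (b - 1) / (R i a (b - 1) * R i a b) else 0)
          + P (i - 1) box + (if a \<in> {r i - r (i + 1)..r i} then Ex i a else 0))"
      using i by (intro sum.cong refl G_wide) auto
    also have "\<dots> =
        (\<Sum>a = 1..<r i. \<Sum>b = 1..m r i. R i (a + 1) b * R i (a - 1) (b - 1) / (R i a (b - 1) * R i a b))
        + of_nat (r i) * P (i - 1) box + (\<Sum>a = r i - r (i + 1)..r i. Ex i a)"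
      unfolding sum.distrib restr[OF sub(1)] restr[OF sub(2)] by simp
    finally have wide: "(\<Sum>a = 1..r i. G \<rho> r q y i (a, m r i) / P i (rect a (m r i))) =
        (\<Sum>a = 1..<r i. \<Sum>b = 1..m r i. R i (a + 1) b * R i (a - 1) (b - 1) / (R i a (b - 1) * R i a b))
        + of_nat (r i) * P (i - 1) box + (\<Sum>a = r i - r (i + 1)..r i. Ex i a)" .
    have "r (i - 1) = r i + m r i" "0 < r i"
      using r_pred_eq[of i] r_pos[of i] i by auto
    then show ?thesis
      using G_tall[OF i] wide by (simp add: sum_max_rects)
  qed
  \<comment> \<open>The r_i wide rectangles contribute r_i copies of p^{i-1}_box, which is
    \<open>t (i - 1)\<close>. Each summand thus carries the difference
    \<open>t i - t (i - 1)\<close> with a minus sign.\<close>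
  define t where "t i = of_nat (r (i + 1)) * P i box" for i
  have "W_R \<rho> r q x = (\<Sum>i = 1..\<rho>.
      (\<Sum>(a, b)\<in>max_rects (r (i - 1)) (r i). G \<rho> r q y i (a, b) / P i (rect a b)) - t i)"
    by (simp add: W_R_def W_P_def P_def t_def flip: y_def)
  also have "\<dots> = (\<Sum>i = 1..\<rho>.
      R i 1 1
      + (\<Sum>a = 1..r i. \<Sum>b = 1..<m r i. R i a (b + 1) * R i (a - 1) (b - 1) / (R i (a - 1) b * R i a b))
      + (\<Sum>a = 1..<r i. \<Sum>b = 1..m r i. R i (a + 1) b * R i (a - 1) (b - 1) / (R i a (b - 1) * R i a b))
      + (\<Sum>a = r i - r (i + 1)..r i. Ex i a) - (t i - t (i - 1)))"
  proof (rule sum.cong)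
    fix i assume i: "i \<in> {1..\<rho>}"
    then have "of_nat (r i) * P (i - 1) box = t (i - 1)"
      by (simp add: t_def)
    then show "(\<Sum>(a, b)\<in>max_rects (r (i - 1)) (r i). G \<rho> r q y i (a, b) / P i (rect a b)) - t i =
      R i 1 1
      + (\<Sum>a = 1..r i. \<Sum>b = 1..<m r i. R i a (b + 1) * R i (a - 1) (b - 1) / (R i (a - 1) b * R i a b))
      + (\<Sum>a = 1..<r i. \<Sum>b = 1..m r i. R i (a + 1) b * R i (a - 1) (b - 1) / (R i a (b - 1) * R i a b))
      + (\<Sum>a = r i - r (i + 1)..r i. Ex i a) - (t i - t (i - 1))"
      unfolding inner[OF i] by simp
  qed simp
  also have "\<dots> = (\<Sum>i = 1..\<rho>.
      R i 1 1
      + (\<Sum>a = 1..r i. \<Sum>b = 1..<m r i. R i a (b + 1) * R i (a - 1) (b - 1) / (R i (a - 1) b * R i a b))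
      + (\<Sum>a = 1..<r i. \<Sum>b = 1..m r i. R i (a + 1) b * R i (a - 1) (b - 1) / (R i a (b - 1) * R i a b))
      + (\<Sum>a = r i - r (i + 1)..r i. Ex i a)) - (\<Sum>i = 1..\<rho>. t i - t (i - 1))"
    by (rule sum_subtractf)
  also have "(\<Sum>i = 1..\<rho>. t i - t (i - 1)) = t \<rho> - t 0"
    by (induction \<rho>) auto
  \<comment> \<open>Here \<open>t \<rho>\<close> vanishes because r_{\<rho>+1} = 0, and
    \<open>t 0\<close> because of the convention p^0 = 0.\<close>
  also have "t \<rho> - t 0 = 0"
    using r_last by (simp add: t_def P_def p_def)
  finally show ?thesis
    by (simp add: Ex_def)
qed

lemma W_R_laurent: "laurent_over_int_q \<rho> (indices \<rho> r) (W_R \<rho> r)"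
proof (rule laurent_over_int_q_cong[OF _ W_R_eq])
  have m: "1 \<le> m r i" if "i \<in> {1..\<rho>}" for i
    using that m_pos by simp
  \<comment> \<open>For i = \<rho> the factor lies outside the index set, but its row number is then
    0 and it is constantly 1.\<close>
  have next_block: "laurent_monomial (indices \<rho> r) (\<lambda>x. rect_value x (i + 1) (a - (r i - r (i + 1))) 1)"
    if "i \<in> {1..\<rho>}" "a \<le> r i" for i a
  proof (cases "i = \<rho>")
    case True
    then show ?thesis
      using that r_last by auto
  next
    case False
    then show ?thesis
      using that m[of "i + 1"] by (intro laurent_monomial_rect_value) auto
  qed
  show "laurent_over_int_q \<rho> (indices \<rho> r) (\<lambda>q x. \<Sum>i = 1..\<rho>.
     rect_value x i 1 1
     + (\<Sum>a = 1..r i. \<Sum>b = 1..<m r i. rect_value x i a (b + 1) * rect_value x i (a - 1) (b - 1)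
          / (rect_value x i (a - 1) b * rect_value x i a b))
     + (\<Sum>a = 1..<r i. \<Sum>b = 1..m r i. rect_value x i (a + 1) b * rect_value x i (a - 1) (b - 1)
          / (rect_value x i a (b - 1) * rect_value x i a b))
     + (\<Sum>a = r i - r (i + 1)..r i. q i * (rect_value x i (a - 1) (m r i - 1)
          * rect_value x (i + 1) (a - (r i - r (i + 1))) 1 / rect_value x i a (m r i))))"
    using m r_pos next_block
    by (intro laurent_over_int_q_sum laurent_over_int_q_add laurent_over_int_q_monomial
        laurent_over_int_q_monomial' laurent_monomial_mult laurent_monomial_divide
        next_block laurent_monomial_rect_value) auto
qed

text \<open>The sums agree term by term. Inside a block the prefactors cancel and the quotient of
  two neighbouring values is the increment of the telescoping; on an exit arrow the prefactors leave
  q_i.\<close>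

lemma W_T_phi:
  assumes q: "\<forall>i\<in>{1..\<rho>}. q i \<noteq> 0" and x: "x \<in> torus (indices \<rho> r)"
  shows "W_T \<rho> r (phi_q q) (phi_z \<rho> r q x) = W_R \<rho> r q x"
proof -
  let ?z = "phi_z \<rho> r q x"
  define R where "R = rect_value x"
  have z: "?z (i, a, b) = phi_q q (i - 1) * R i a b / R i (a - 1) (b - 1)"
    if "i \<in> {1..\<rho>}" "a \<in> {1..r i}" "b \<in> {1..m r i}" for i a b
    unfolding R_def using that by (intro phi_z_eq) (simp add: indices_def)
  have Rnz: "R i a b \<noteq> 0" if "i \<in> {1..\<rho>}" "a \<le> r i" "b \<le> m r i" for i a b
    unfolding R_def using x that by (rule rect_value_nonzero)
  have Q: "phi_q q (i - 1) \<noteq> 0" if "i \<in> {1..\<rho>}" for i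
    using that by (intro phi_q_nonzero[OF q]) auto
  \<comment> \<open>For i = 0 the prescribed value 1 is the empty product.\<close>
  have ext: "vertex_value (phi_q q) ?z (Ext i) = phi_q q i" for i
    by (simp add: phi_q_def)
  have Q_step: "phi_q q i = q i * phi_q q (i - 1)" if "i \<in> {1..\<rho>}" for i
    using that by (cases i) (auto simp: phi_q_def)
  have R0: "R i 0 b = 1" "R i a 0 = 1" for i a b
    by (simp_all add: R_def)
  show ?thesis
    unfolding W_T_eq W_R_eq[OF x]
  proof (intro sum.cong refl arg_cong2[where f = "(+)"])
    fix i assume i: "i \<in> {1..\<rho>}"
    show "?z (i, 1, 1) / vertex_value (phi_q q) ?z (Ext (i - 1)) = rect_value x i 1 1"
      unfolding ext using i m_pos[of i] r_pos[of i] Q[OF i] by (subst z) (auto simp: R0 R_def)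
  next
    fix i a b assume *: "i \<in> {1..\<rho>}" "a \<in> {1..r i}" "b \<in> {1..<m r i}"
    then have "?z (i, a, b + 1) / ?z (i, a, b) =
        R i a (b + 1) * R i (a - 1) (b - 1) / (R i (a - 1) b * R i a b)"
      using Q[of i] Rnz[of i a b] Rnz[of i "a - 1" b] Rnz[of i "a - 1" "b - 1"]
      by (simp add: z field_simps)
    then show "?z (i, a, b + 1) / ?z (i, a, b) = rect_value x i a (b + 1) * rect_value x i (a - 1) (b - 1)
        / (rect_value x i (a - 1) b * rect_value x i a b)"
      by (simp add: R_def)
  next
    fix i a b assume *: "i \<in> {1..\<rho>}" "a \<in> {1..<r i}" "b \<in> {1..m r i}"
    then have "?z (i, a + 1, b) / ?z (i, a, b) =
        R i (a + 1) b * R i (a - 1) (b - 1) / (R i a (b - 1) * R i a b)"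
      using Q[of i] Rnz[of i a b] Rnz[of i a "b - 1"] Rnz[of i "a - 1" "b - 1"]
      by (simp add: z field_simps)
    then show "?z (i, a + 1, b) / ?z (i, a, b) = rect_value x i (a + 1) b * rect_value x i (a - 1) (b - 1)
        / (rect_value x i a (b - 1) * rect_value x i a b)"
      by (simp add: R_def)
  next
    fix i a assume i: "i \<in> {1..\<rho>}" and a: "a \<in> {r i - r (i + 1)..r i}"
    have dec: "r (i + 1) < r i"
      using i by (intro r_decreasing) auto
    \<comment> \<open>Both kinds of exit target fit one formula: \<open>Ext i\<close> is the case of
      an empty column, and a box in the first column of block i+1 has the denominator p_empty =
      1.\<close>
    have "vertex_value (phi_q q) ?z (exit_target i a) = phi_q q i * R (i + 1) (a - (r i - r (i + 1))) 1"
    proof (cases "a = r i - r (i + 1)")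
      case True
      then show ?thesis
        by (simp add: exit_target_def ext R0 del: vertex_value.simps(2))
    next
      case False
      then have "i \<noteq> \<rho>"
        using a r_last by auto
      then have "?z (i + 1, a - (r i - r (i + 1)), 1) = phi_q q i * R (i + 1) (a - (r i - r (i + 1))) 1"
        using i a False dec m_pos[of "i + 1"] by (subst z) (auto simp: R0)
      then show ?thesis
        using False by (simp add: exit_target_def)
    qed
    moreover have "?z (i, a, m r i) = phi_q q (i - 1) * R i a (m r i) / R i (a - 1) (m r i - 1)"
      using i a dec m_pos[of i] by (intro z) auto
    ultimately have "vertex_value (phi_q q) ?z (exit_target i a) / ?z (i, a, m r i) =
        q i * (R i (a - 1) (m r i - 1) * R (i + 1) (a - (r i - r (i + 1))) 1 / R i a (m r i))"
      using Q[OF i] Rnz[OF i, of "a - 1" "m r i - 1"] a by (simp add: Q_step[OF i])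
    then show "vertex_value (phi_q q) ?z (exit_target i a) / ?z (i, a, m r i) =
        q i * (rect_value x i (a - 1) (m r i - 1) * rect_value x (i + 1) (a - (r i - r (i + 1))) 1
          / rect_value x i a (m r i))"
      by (simp add: R_def)
  qed
qed

end

theorem theorem1p1:
  fixes n \<rho> :: nat and r :: "nat \<Rightarrow> nat"
  assumes "1 \<le> \<rho>"
    and "r 0 = n"
    and "\<forall>i\<le>\<rho>. r (i + 1) < r i"
    and "r (\<rho> + 1) = 0"
  shows "bij_betw (rect_coords \<rho> r) (rect_locus \<rho> r) (torus (indices \<rho> r)) \<and>
    laurent_over_int_q \<rho> (indices \<rho> r) (W_R \<rho> r) \<and>
    (\<forall>q. (\<forall>i\<in>{1..\<rho>}. q i \<noteq> 0) \<longrightarrow>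
       torus_iso (indices \<rho> r) (indices \<rho> r) (phi_z \<rho> r q) \<and>
       (\<forall>x\<in>torus (indices \<rho> r).
          W_T \<rho> r (phi_q q) (phi_z \<rho> r q x) = W_R \<rho> r q x))"
proof -
  interpret flag_type \<rho> r
    using assms by unfold_locales auto
  show ?thesis
    using rect_coords_bij W_R_laurent torus_iso_phi W_T_phi by blast
qed

end
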